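(* Let $E$ be a uniformly smooth and uniformly convex real Banach space with dual $E^*$, and let $p,q>1$ with $\frac1p+\frac1q=1$. Suppose $F:E\to E^*$ is a generalized $\Phi_1$-strongly monotone mapping such that $R(J_p+t_1F)=E^*$ for all $t_1>0$, and $K:E^*\to E$ is a generalized $\Phi_2$-strongly monotone mapping such that $R(J_q+t_2K)=E$ for all $t_2>0$. Let $W:=E\times E^*$ with norm $\|w\|_W:=\|u\|_E+\|v\|_{E^*}$ for $w=(u,v)\in W$, and define $A:W\to W^*$ by $$Aw=(Fu-v,\;Kv+u)\qquad\text{for all } w=(u,v)\in W.$$ Then $R(J_p^W+tA)=W^*$ for all $t>0$, where $J_p^W:W\to W^*$ is the mapping $J_p^W(u,v)=(J_pu,\;J_qv)$.
   Context: For $p>1$ and a smooth Banach space $X$, the generalized duality mapping $J_p:X\to X^*$ assigns to $x$ the unique $f\in X^*$ with $\langle x,f\rangle=\|x\|\,\|f\|$ and $\|f\|=\|x\|^{p-1}$. Here $J_p:E\to E^*$ is the generalized duality mapping of $E$ with exponent $p$, and $J_q:E^*\to E$ (using reflexivity, $E^{**}=E$) is that of $E^*$ with exponent $q$; $J_q=J_p^{-1}$. $R(\cdot)$ denotes range. $W^*$ is identified with $E^*\times E$ via $\langle(a,b),(u,v)\rangle=\langle a,u\rangle+\langle b,v\rangle$. A single-valued mapping $T$ from a Banach space $X$ to $X^*$ is generalized $\Phi$-strongly monotone if $\Phi:[0,\infty)\to[0,\infty)$ is a strictly increasing function with $\Phi(0)=0$ and $\langle Tx-Ty,x-y\rangle\ge\Phi(\|x-y\|)$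 for all $x,y\in D(T)$. *)

theory Defs
  imports "HOL-Analysis.Analysis"
begin

type_synonym 'a dual = "'a \<Rightarrow>\<^sub>L real"

definition uniformly_convex :: "'a::real_normed_vector itself \<Rightarrow> bool" where
  "uniformly_convex _ \<longleftrightarrow>
     (\<forall>\<epsilon>. 0 < \<epsilon> \<and> \<epsilon> \<le> 2 \<longrightarrow>
        (\<exists>\<delta>>0. \<forall>x y :: 'a. norm x = 1 \<and> norm y = 1 \<and> norm (x - y) \<ge> \<epsilon> \<longrightarrow>
           norm ((x + y) /\<^sub>R 2) \<le> 1 - \<delta>))"

(* Equivalent to rho(tau)/tau -> 0 for the modulus of smoothness rho; this form also
   makes sense for the zero space, whose unit sphere is empty. *)
definition uniformly_smooth :: "'a::real_normed_vector itself \<Rightarrow> bool" where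
  "uniformly_smooth _ \<longleftrightarrow>
     (\<forall>\<epsilon>>0. \<exists>\<delta>>0. \<forall>x y :: 'a. norm x = 1 \<and> norm y \<le> \<delta> \<longrightarrow>
        norm (x + y) + norm (x - y) \<le> 2 + \<epsilon> * norm y)"

definition duality_map :: "real \<Rightarrow> 'a::real_normed_vector \<Rightarrow> 'a dual" where
  "duality_map p x =
     (THE f. blinfun_apply f x = norm x * norm f \<and> norm f = norm x powr (p - 1))"

definition bidual_embed :: "'a::real_normed_vector \<Rightarrow> 'a dual dual" where
  "bidual_embed x = Blinfun (\<lambda>f. blinfun_apply f x)"

lemma bidual_embed_apply [simp]: "blinfun_apply (bidual_embed x) f = blinfun_apply f x"
  unfolding bidual_embed_def
  by (simp add: bounded_linear_Blinfun_apply blinfun.bounded_linear_left)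

(* The duality mapping of the dual space, whose values lie in the bidual, read as a map
   back into the space itself. Only meaningful when the canonical embedding is onto;
   uniformly convex Banach spaces are reflexive by Milman-Pettis. *)
definition predual_duality_map :: "real \<Rightarrow> 'a::real_normed_vector dual \<Rightarrow> 'a" where
  "predual_duality_map q f = inv bidual_embed (duality_map q f)"

definition gen_strongly_monotone ::
    "(real \<Rightarrow> real) \<Rightarrow> ('a::real_normed_vector \<Rightarrow> 'a dual) \<Rightarrow> bool" where
  "gen_strongly_monotone \<Phi> T \<longleftrightarrow>
     \<Phi> \<in> {0..} \<rightarrow> {0..} \<and> strict_mono_on {0..} \<Phi> \<and> \<Phi> 0 = 0 \<and>
     (\<forall>x y. blinfun_apply (T x - T y) (x - y) \<ge> \<Phi> (norm (x - y)))"

(* The library's norm on product types is the Euclidean one, so the product with the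
   norm |u| + |v| is a type of its own. *)
datatype ('a, 'b) l1_prod = L1 (l1_fst: 'a) (l1_snd: 'b)

instantiation l1_prod :: (real_vector, real_vector) real_vector
begin

definition "0 = L1 0 0"
definition "w + w' = L1 (l1_fst w + l1_fst w') (l1_snd w + l1_snd w')"
definition "w - w' = L1 (l1_fst w - l1_fst w') (l1_snd w - l1_snd w')"
definition "- w = L1 (- l1_fst w) (- l1_snd w)"
definition "c *\<^sub>R w = L1 (c *\<^sub>R l1_fst w) (c *\<^sub>R l1_snd w)"

instance
  by standard
    (simp_all add: zero_l1_prod_def plus_l1_prod_def minus_l1_prod_def uminus_l1_prod_def
       scaleR_l1_prod_def scaleR_add_left scaleR_add_right)

end

instantiation l1_prod :: (real_normed_vector, real_normed_vector) real_normed_vector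
begin

definition "norm w = norm (l1_fst w) + norm (l1_snd w)"
definition "sgn (w :: ('a, 'b) l1_prod) = w /\<^sub>R norm w"
definition "dist (w :: ('a, 'b) l1_prod) w' = norm (w - w')"
definition [code del]:
  "(uniformity :: (('a, 'b) l1_prod \<times> ('a, 'b) l1_prod) filter) =
     (INF e\<in>{0<..}. principal {(x, y). dist x y < e})"
definition [code del]:
  "open (U :: ('a, 'b) l1_prod set) \<longleftrightarrow>
     (\<forall>x\<in>U. eventually (\<lambda>(x', y). x' = x \<longrightarrow> y \<in> U) uniformity)"

instance
proof
  fix x y :: "('a, 'b) l1_prod" and a :: real
  show "norm x = 0 \<longleftrightarrow> x = 0"
    by (cases x) (auto simp: norm_l1_prod_def zero_l1_prod_def add_nonneg_eq_0_iff)
  have "norm (l1_fst x + l1_fst y) \<le> norm (l1_fst x) + norm (l1_fst y)"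
    and "norm (l1_snd x + l1_snd y) \<le> norm (l1_snd x) + norm (l1_snd y)"
    by (rule norm_triangle_ineq)+
  then show "norm (x + y) \<le> norm x + norm y"
    by (simp add: norm_l1_prod_def plus_l1_prod_def)
  show "norm (a *\<^sub>R x) = \<bar>a\<bar> * norm x"
    by (simp add: norm_l1_prod_def scaleR_l1_prod_def algebra_simps)
qed (simp_all add: sgn_l1_prod_def dist_l1_prod_def uniformity_l1_prod_def open_l1_prod_def)

end

(* The identification of E* x E with the dual of W = E x E*. *)
definition pair_dual ::
    "'a::real_normed_vector dual \<times> 'a \<Rightarrow> ('a, 'a dual) l1_prod dual" where
  "pair_dual = (\<lambda>(a, b). Blinfun (\<lambda>w. blinfun_apply a (l1_fst w) + blinfun_apply (l1_snd w) b))"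

lemma pair_dual_apply [simp]:
  "blinfun_apply (pair_dual (a, b)) (L1 u v) = blinfun_apply a u + blinfun_apply v b"
proof -
  have "bounded_linear (\<lambda>w. blinfun_apply a (l1_fst w) + blinfun_apply (l1_snd w) b)"
  proof (rule bounded_linear_intro[where K = "norm a + norm b"])
    fix w :: "('a, 'a dual) l1_prod"
    have "\<bar>blinfun_apply a (l1_fst w)\<bar> \<le> norm a * norm (l1_fst w)"
      and "\<bar>blinfun_apply (l1_snd w) b\<bar> \<le> norm (l1_snd w) * norm b"
      using norm_blinfun[of a "l1_fst w"] norm_blinfun[of "l1_snd w" b] by simp_all
    moreover have "0 \<le> norm a * norm (l1_snd w)" "0 \<le> norm b * norm (l1_fst w)"
      by simp_all
    ultimately show "norm (blinfun_apply a (l1_fst w) + blinfun_apply (l1_snd w) b)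
        \<le> norm w * (norm a + norm b)"
      unfolding norm_l1_prod_def real_norm_def by (simp only: algebra_simps)
  qed (simp_all add: plus_l1_prod_def scaleR_l1_prod_def blinfun.bilinear_simps algebra_simps)
  then show ?thesis
    by (simp add: pair_dual_def bounded_linear_Blinfun_apply)
qed

definition duality_map_W ::
    "real \<Rightarrow> real \<Rightarrow> ('a::real_normed_vector, 'a dual) l1_prod \<Rightarrow> ('a, 'a dual) l1_prod dual" where
  "duality_map_W p q w = pair_dual (duality_map p (l1_fst w), predual_duality_map q (l1_snd w))"

definition hammerstein_map ::
    "('a::real_normed_vector \<Rightarrow> 'a dual) \<Rightarrow> ('a dual \<Rightarrow> 'a) \<Rightarrow>
     ('a, 'a dual) l1_prod \<Rightarrow> ('a, 'a dual) l1_prod dual" where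
  "hammerstein_map F K w =
     pair_dual (F (l1_fst w) - l1_snd w, K (l1_snd w) + l1_fst w)"

end

theory Submission
  imports Defs
begin

text \<open>With \<open>P = t F - a\<close> and \<open>Q = t K - b\<close> the task is to solve \<open>J\<^sub>p u + P u = t v\<close> and
  \<open>J\<^sub>q v + Q v = - t u\<close>. The range conditions make \<open>P\<close> and \<open>Q\<close> maximal monotone, so their Fitzpatrick
  functions dominate the duality pairing, with equality only on the graphs. Because the coupling is
  skew, the sum of the two functions at \<open>(u, a + t v)\<close> and \<open>(v, b - t u)\<close> represents the coupled
  operator. Adding \<open>\<parallel>u\<parallel>\<^sup>p/p + \<parallel>v\<parallel>\<^sup>q/q + \<parallel>a\<parallel>\<^sup>q/q + \<parallel>b\<parallel>\<^sup>p/p\<close> gives a coercive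
  uniformly convex function, which has a minimiser; Young's inequality turns the variational
  inequality at the minimiser into the two equations.\<close>

subsection \<open>Powers and uniformly convex norms\<close>

text \<open>The skew coupling \<open>(u, v) \<mapsto> (- v, u)\<close> is not a gradient, and
  \<open>F\<close> and \<open>K\<close> need not be gradients either, so the two equations are not
  the Euler equations of a functional of \<open>(u, v)\<close> alone. Fitzpatrick functions get
  around this by treating the values of the coupled operator as further unknowns, which turns the
  problem into convex minimisation with minimum value zero. They may take the value infinity, so
  they enter only through an epigraph. Completeness takes the place of weak compactness: uniform
  smoothness of the space makes its dual uniformly convex, hence all four power terms are uniformly
  convex on bounded sets and minimising sequences are Cauchy. The same Cauchy argument makes
  functionals attain their norms, which leads to the reflexivity behind \<open>J\<^sub>q\<close> and
  behind the identification of the dual of \<open>W\<close> with pairs. The duality mappings act as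
  continuous gradients of the power terms, so the variational inequality comes from one-sided
  difference quotients.\<close>

lemma powr_above_tangent:
  fixes s c r :: real
  assumes r: "r > 1" and "s \<ge> 0" "c \<ge> 0" "s \<noteq> c"
  shows "c powr r + r * c powr (r - 1) * (s - c) < s powr r"
proof -
  \<comment> \<open>The derivative of \<open>x powr r\<close> is used only at positive arguments, so
    an endpoint 0 cannot go through the mean value theorem and is computed directly.\<close>
  consider "c = 0" | "s = 0" "c > 0" | "s > 0" "c > 0" using assms by fastforce
  then show ?thesis
  proof cases
    case 1 then show ?thesis using assms by simp
  next
    case 2
    have "c powr (r - 1) * c = c powr r" using 2 r by (simp add: powr_mult_base mult.commute)
    moreover have "c powr r > 0" using 2 by simp
    ultimately show ?thesis using 2 r by (simp add: mult.assoc)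
  next
    case 3
    have der: "((\<lambda>x. x powr r) has_real_derivative r * x powr (r - 1)) (at x)" if "x > 0" for x
      using that by (rule has_real_derivative_powr)
    show ?thesis
    proof (cases "c < s")
      case True
      obtain z where z: "c < z" "z < s" "s powr r - c powr r = (s - c) * (r * z powr (r - 1))"
        using MVT2[of c s "\<lambda>x. x powr r" "\<lambda>x. r * x powr (r - 1)"] True der 3 by force
      have "c powr (r - 1) < z powr (r - 1)" using z 3 r by (intro powr_less_mono2) auto
      then have "(s - c) * (r * c powr (r - 1)) < (s - c) * (r * z powr (r - 1))"
        using True r by simp
      then show ?thesis using z by (simp add: mult_ac)
    next
      case False
      then have sc: "s < c" using assms by simp
      obtain z where z: "s < z" "z < c" "c powr r - s powr r = (c - s) * (r * z powr (r - 1))"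
        using MVT2[of s c "\<lambda>x. x powr r" "\<lambda>x. r * x powr (r - 1)"] sc der 3 by force
      have "z powr (r - 1) < c powr (r - 1)" using z 3 r by (intro powr_less_mono2) auto
      then have "(c - s) * (r * z powr (r - 1)) < (c - s) * (r * c powr (r - 1))"
        using sc r by simp
      then show ?thesis using z by (simp add: algebra_simps)
    qed
  qed
qed

lemma powr_ge_tangent:
  fixes s c r :: real
  assumes "r > 1" "s \<ge> 0" "c \<ge> 0"
  shows "c powr r + r * c powr (r - 1) * (s - c) \<le> s powr r"
  using powr_above_tangent[OF assms] by (cases "s = c") auto

lemma powr_midpoint_le:
  fixes s c r :: real
  assumes "r > 1" "s \<ge> 0" "c \<ge> 0"
  shows "((s + c) / 2) powr r \<le> (s powr r + c powr r) / 2"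
proof -
  \<comment> \<open>Both tangents are taken at the midpoint \<open>m\<close>, where the terms
    \<open>k * d\<close> and \<open>k * (- d)\<close> cancel on adding.\<close>
  define m d where "m = (s + c) / 2" and "d = (s - c) / 2"
  define k where "k = r * m powr (r - 1)"
  have "m \<ge> 0" "s - m = d" "c - m = - d"
    using assms by (simp_all add: m_def d_def field_simps)
  then have "m powr r + k * d \<le> s powr r" "m powr r + k * (- d) \<le> c powr r"
    using assms powr_ge_tangent[of r s m] powr_ge_tangent[of r c m] by (simp_all add: k_def)
  then show ?thesis unfolding m_def[symmetric] by simp
qed

lemma powr_midpoint_eqD:
  fixes s c r :: real
  assumes "r > 1" "s \<ge> 0" "c \<ge> 0" "(s powr r + c powr r) / 2 \<le> ((s + c) / 2) powr r"
  shows "s = c"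
proof (rule ccontr)
  define m d where "m = (s + c) / 2" and "d = (s - c) / 2"
  define k where "k = r * m powr (r - 1)"
  assume "s \<noteq> c"
  then have "m \<ge> 0" "s - m = d" "c - m = - d" "s \<noteq> m" "c \<noteq> m"
    using assms by (simp_all add: m_def d_def field_simps)
  then have "m powr r + k * d < s powr r" "m powr r + k * (- d) < c powr r"
    using assms powr_above_tangent[of r s m] powr_above_tangent[of r c m] by (simp_all add: k_def)
  then show False using assms(4) unfolding m_def[symmetric] by simp
qed

lemma conjugate_exponents:
  fixes p q :: real
  assumes "p > 1" "q > 1" "1 / p + 1 / q = 1"
  shows "(p - 1) * (q - 1) = 1" "(p - 1) * q = p" "(q - 1) * p = q"
  using assms by (auto simp: field_simps)

text \<open>The tangent to \<open>s powr p\<close> is taken at \<open>c powr (q - 1)\<close>, the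
  point where the slope is \<open>p * c\<close>. It is strict elsewhere, so equality forces
  \<open>s\<close> to be that point.\<close>

lemma Young_powr:
  fixes s c p q :: real
  assumes pq: "p > 1" "q > 1" "1 / p + 1 / q = 1" and "s \<ge> 0" "c \<ge> 0"
  shows "s * c \<le> s powr p / p + c powr q / q"
    and "s * c = s powr p / p + c powr q / q \<Longrightarrow> c = s powr (p - 1)"
proof -
  note ex = conjugate_exponents[OF pq]
  let ?d = "c powr (q - 1)"
  have d: "?d powr (p - 1) = c" "?d powr p = c powr q"
    using ex(1,3) assms by (simp_all only: powr_powr mult.commute[of "q - 1"] powr_one)
  have "?d * c = c powr q"
    using powr_mult_base[of c "q - 1"] assms by (simp add: mult.commute)
  then have eq: "?d powr p + p * ?d powr (p - 1) * (s - ?d) = p * (s * c - c powr q / q)"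
  proof -
    have "p / q = p - 1" using ex(2) pq by (simp add: field_simps)
    then have "p * (s * c - c powr q / q) = p * (s * c) - (p - 1) * c powr q"
      by (metis right_diff_distrib times_divide_eq_left times_divide_eq_right)
    then show ?thesis using \<open>?d * c = c powr q\<close> unfolding d by (simp add: algebra_simps)
  qed
  have *: "p * (s * c - c powr q / q) \<le> s powr p"
    using powr_ge_tangent[of p s ?d] assms eq by simp
  then show "s * c \<le> s powr p / p + c powr q / q"
  proof -
    have "s * c - c powr q / q \<le> s powr p / p"
      using * pq(1) by (simp only: pos_le_divide_eq mult.commute[of _ p])
    then show ?thesis by simp
  qed
  show "c = s powr (p - 1)" if "s * c = s powr p / p + c powr q / q"
  proof -
    have "p * (s * c - c powr q / q) = s powr p" using that pq by simp
    then have "s = ?d" using powr_above_tangent[of p s ?d] assms eq by force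
    then show ?thesis using d by simp
  qed
qed

section \<open>Uniform convexity along sequences\<close>

text \<open>The modulus concerns unit vectors only. Since the norms converge to \<rho> > 0,
  \<open>sgn (x n)\<close> differs from \<open>x n /\<^sub>R \<rho>\<close> by a null sequence, so
  the modulus applies to the normalised vectors and the result is scaled back. The lower bound
  \<open>l\<close> lets applications supply an estimate instead of the limit of
  \<open>norm (x n + y n)\<close>.\<close>

lemma uniformly_convex_seq:
  fixes x y :: "nat \<Rightarrow> 'x::real_normed_vector"
  assumes uc: "uniformly_convex TYPE('x)"
    and x: "(\<lambda>n. norm (x n)) \<longlonglongrightarrow> \<rho>" and y: "(\<lambda>n. norm (y n)) \<longlonglongrightarrow> \<rho>"
    and xy: "\<And>n. l n \<le> norm (x n + y n)" and l: "l \<longlonglongrightarrow> 2 * \<rho>"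
  shows "(\<lambda>n. x n - y n) \<longlonglongrightarrow> 0"
proof -
  have nn: "\<rho> \<ge> 0" using x by (rule LIMSEQ_le_const) auto
  show ?thesis
  proof (cases "\<rho> = 0")
    case True
    have "x \<longlonglongrightarrow> 0" "y \<longlonglongrightarrow> 0" using x y True by (simp_all add: tendsto_norm_zero_iff)
    then show ?thesis using tendsto_diff[of x 0 _ y 0] by simp
  next
    case False
    then have pos: "\<rho> > 0" using nn by simp
    have sum: "(\<lambda>n. norm (x n + y n)) \<longlonglongrightarrow> 2 * \<rho>"
    proof (rule tendsto_sandwich[OF _ _ l])
      show "\<forall>\<^sub>F n in sequentially. l n \<le> norm (x n + y n)" using xy by simp
      show "\<forall>\<^sub>F n in sequentially. norm (x n + y n) \<le> norm (x n) + norm (y n)"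
        by (simp add: norm_triangle_ineq)
      show "(\<lambda>n. norm (x n) + norm (y n)) \<longlonglongrightarrow> 2 * \<rho>" using tendsto_add[OF x y] by simp
    qed
    define x' where "x' n = sgn (x n)" for n
    define y' where "y' n = sgn (y n)" for n
    have near: "(\<lambda>n. sgn (z n) - z n /\<^sub>R \<rho>) \<longlonglongrightarrow> 0"
      if z: "(\<lambda>n. norm (z n)) \<longlonglongrightarrow> \<rho>" for z :: "nat \<Rightarrow> 'x"
    proof -
      have "(\<lambda>n. \<bar>inverse (norm (z n)) - inverse \<rho>\<bar> * norm (z n)) \<longlonglongrightarrow> \<bar>inverse \<rho> - inverse \<rho>\<bar> * \<rho>"
        using pos by (intro tendsto_intros z) auto
      then have "(\<lambda>n. norm ((inverse (norm (z n)) - inverse \<rho>) *\<^sub>R z n)) \<longlonglongrightarrow> 0" by simp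
      then show ?thesis
        by (simp add: tendsto_norm_zero_iff scaleR_left_diff_distrib sgn_div_norm)
    qed
    have dx: "(\<lambda>n. x' n - x n /\<^sub>R \<rho>) \<longlonglongrightarrow> 0" and dy: "(\<lambda>n. y' n - y n /\<^sub>R \<rho>) \<longlonglongrightarrow> 0"
      using near[OF x] near[OF y] by (simp_all add: x'_def y'_def)
    have "(\<lambda>n. norm ((x n + y n) /\<^sub>R \<rho>)) \<longlonglongrightarrow> inverse \<rho> * (2 * \<rho>)"
      using pos tendsto_mult[OF tendsto_const sum, of "inverse \<rho>"] by simp
    then have s1: "(\<lambda>n. norm ((x n + y n) /\<^sub>R \<rho>)) \<longlonglongrightarrow> 2"
      by (rule tendsto_eq_rhs) (use pos in simp)
    have s2: "(\<lambda>n. norm ((x' n - x n /\<^sub>R \<rho>) + (y' n - y n /\<^sub>R \<rho>))) \<longlonglongrightarrow> 0"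
      using tendsto_norm[OF tendsto_add[OF dx dy]] by simp
    have s3: "(\<lambda>n. norm ((x n + y n) /\<^sub>R \<rho>) - norm ((x' n - x n /\<^sub>R \<rho>) + (y' n - y n /\<^sub>R \<rho>))) \<longlonglongrightarrow> 2"
      using tendsto_diff[OF s1 s2] by simp
    have low: "norm ((x n + y n) /\<^sub>R \<rho>) - norm ((x' n - x n /\<^sub>R \<rho>) + (y' n - y n /\<^sub>R \<rho>)) \<le> norm (x' n + y' n)" for n
      using norm_triangle_ineq4[of "x' n + y' n" "(x' n - x n /\<^sub>R \<rho>) + (y' n - y n /\<^sub>R \<rho>)"]
      by (simp add: algebra_simps)
    have evx: "\<forall>\<^sub>F n in sequentially. norm (x n) > 0" "\<forall>\<^sub>F n in sequentially. norm (y n) > 0"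
      using order_tendstoD(1)[OF x pos] order_tendstoD(1)[OF y pos] by auto
    have d': "(\<lambda>n. x' n - y' n) \<longlonglongrightarrow> 0"
    proof (rule LIMSEQ_I)
      fix \<epsilon>' :: real assume e': "0 < \<epsilon>'"
      \<comment> \<open>\<open>uniformly_convex\<close> provides a modulus only for separations up
        to 2.\<close>
      define \<epsilon> where "\<epsilon> = min \<epsilon>' 2"
      have e: "0 < \<epsilon>" "\<epsilon> \<le> 2" "\<epsilon> \<le> \<epsilon>'" using e' by (auto simp: \<epsilon>_def)
      obtain \<delta> where \<delta>: "\<delta> > 0"
        "\<And>a b :: 'x. norm a = 1 \<Longrightarrow> norm b = 1 \<Longrightarrow> norm (a - b) \<ge> \<epsilon> \<Longrightarrow> norm ((a + b) /\<^sub>R 2) \<le> 1 - \<delta>"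
        using uc[unfolded uniformly_convex_def, rule_format, OF conjI[OF e(1,2)]] by metis
      have "\<forall>\<^sub>F n in sequentially. norm (x' n + y' n) > 2 - 2 * \<delta>"
        using order_tendstoD(1)[OF s3, of "2 - 2 * \<delta>"] \<delta>(1) low
        by (auto elim!: eventually_mono intro: less_le_trans)
      with evx have "\<forall>\<^sub>F n in sequentially. norm (x' n - y' n - 0) < \<epsilon>'"
      proof eventually_elim
        case (elim n)
        then have "norm (x' n) = 1" "norm (y' n) = 1" by (auto simp: x'_def y'_def norm_sgn)
        then show ?case using \<delta>(2)[of "x' n" "y' n"] elim(3) e by fastforce
      qed
      then show "\<exists>no. \<forall>n\<ge>no. norm (x' n - y' n - 0) < \<epsilon>'" by (simp add: eventually_sequentially)
    qed
    have "(\<lambda>n. \<rho> *\<^sub>R ((x' n - y' n) - ((x' n - x n /\<^sub>R \<rho>) - (y' n - y n /\<^sub>R \<rho>)))) \<longlonglongrightarrow> \<rho> *\<^sub>R (0 - (0 - 0))"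
      by (intro tendsto_intros d' dx dy)
    then show ?thesis using pos by (simp add: algebra_simps)
  qed
qed

text \<open>In the unit ball a sum of norm close to 2 already forces both norms close to 1, so a
  sequence of counterexamples contradicts \<open>uniformly_convex_seq\<close>.\<close>

lemma uniformly_convex_unit_ball:
  assumes uc: "uniformly_convex TYPE('x::real_normed_vector)" and e: "\<epsilon> > 0"
  obtains \<delta> where "\<delta> > 0" "\<And>x y :: 'x. norm x \<le> 1 \<Longrightarrow> norm y \<le> 1 \<Longrightarrow> norm (x + y) \<ge> 2 - \<delta> \<Longrightarrow> norm (x - y) < \<epsilon>"
proof -
  have "\<exists>\<delta>>0. \<forall>x y :: 'x. norm x \<le> 1 \<longrightarrow> norm y \<le> 1 \<longrightarrow> norm (x + y) \<ge> 2 - \<delta> \<longrightarrow> norm (x - y) < \<epsilon>"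
  proof (rule ccontr)
    assume neg: "\<not> ?thesis"
    have "\<exists>x y :: 'x. norm x \<le> 1 \<and> norm y \<le> 1 \<and> norm (x + y) \<ge> 2 - inverse (real (Suc n)) \<and> norm (x - y) \<ge> \<epsilon>" for n
      using neg by (metis inverse_positive_iff_positive not_le of_nat_0_less_iff zero_less_Suc)
    then obtain x y :: "nat \<Rightarrow> 'x" where xy: "\<And>n. norm (x n) \<le> 1" "\<And>n. norm (y n) \<le> 1"
      "\<And>n. norm (x n + y n) \<ge> 2 - inverse (real (Suc n))" "\<And>n. norm (x n - y n) \<ge> \<epsilon>"
      by metis
    have l: "(\<lambda>n. c - inverse (real (Suc n))) \<longlonglongrightarrow> c" for c
      using tendsto_diff[OF tendsto_const LIMSEQ_inverse_real_of_nat, of c] by simp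
    have "1 - inverse (real (Suc n)) \<le> norm (x n)" "1 - inverse (real (Suc n)) \<le> norm (y n)" for n
      using xy(1-3)[of n] norm_triangle_ineq[of "x n" "y n"] by linarith+
    then have "(\<lambda>n. norm (x n)) \<longlonglongrightarrow> 1" "(\<lambda>n. norm (y n)) \<longlonglongrightarrow> 1"
      using xy by (auto intro!: tendsto_sandwich[OF _ _ l tendsto_const] always_eventually)
    then have "(\<lambda>n. x n - y n) \<longlonglongrightarrow> 0"
      using l[of 2] xy(3) by (intro uniformly_convex_seq[OF uc, where \<rho> = 1]) auto
    then have "(\<lambda>n. norm (x n - y n)) \<longlonglongrightarrow> 0" by (rule tendsto_norm_zero)
    then have "\<epsilon> \<le> 0" by (rule LIMSEQ_le_const) (use xy in auto)
    then show False using e by simp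
  qed
  then show ?thesis using that by blast
qed

text \<open>Constant sequences in \<open>uniformly_convex_seq\<close>. This strict convexity makes
  the values of the duality mappings unique.\<close>

lemma uniformly_convex_strict:
  fixes x y :: "'x::real_normed_vector"
  assumes "uniformly_convex TYPE('x)" "norm x = \<rho>" "norm y = \<rho>" "norm (x + y) \<ge> 2 * \<rho>"
  shows "x = y"
proof -
  have "(\<lambda>n::nat. x - y) \<longlonglongrightarrow> 0"
    using assms by (intro uniformly_convex_seq[where \<rho> = \<rho> and l = "\<lambda>_. 2 * \<rho>"]) auto
  then show ?thesis by (simp add: LIMSEQ_const_iff)
qed

subsection \<open>Minimisation of uniformly convex functions\<close>

text \<open>The modulus may depend on the radius because \<open>norm x powr r\<close> with
  \<open>r < 2\<close> flattens out at infinity. Midpoints suffice, since the Cauchy argument for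
  minimising sequences only averages two points.\<close>

definition uniformly_convex_on_bounded :: "('x::real_normed_vector \<Rightarrow> real) \<Rightarrow> bool" where
  "uniformly_convex_on_bounded g \<longleftrightarrow>
     (\<forall>x y. g ((x + y) /\<^sub>R 2) \<le> (g x + g y) / 2) \<and>
     (\<forall>R. \<forall>\<epsilon>>0. \<exists>\<delta>>0. \<forall>x y. norm x \<le> R \<longrightarrow> norm y \<le> R \<longrightarrow>
        (g x + g y) / 2 - \<delta> \<le> g ((x + y) /\<^sub>R 2) \<longrightarrow> norm (x - y) < \<epsilon>)"

text \<open>For a sequence of counterexamples the pairs of norms lie in a bounded set of the plane,
  so a subsequence has norms converging to \<rho> and \<sigma>. Strict convexity of the scalar power
  gives \<rho> = \<sigma>; then the norms of the sums tend to \<open>2 * \<rho>\<close> and uniform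
  convexity of the norm applies.\<close>

lemma norm_powr_uniformly_convex_on_bounded:
  assumes uc: "uniformly_convex TYPE('x::real_normed_vector)" and r: "r > 1"
  shows "uniformly_convex_on_bounded (\<lambda>x::'x. norm x powr r / r)"
proof -
  have mid: "norm ((x + y) /\<^sub>R 2) powr r \<le> ((norm x + norm y) / 2) powr r" for x y :: 'x
    using r norm_triangle_ineq[of x y] by (intro powr_mono2) auto
  have cvx: "norm ((x + y) /\<^sub>R 2) powr r / r \<le> (norm x powr r / r + norm y powr r / r) / 2" for x y :: 'x
  proof -
    have "norm ((x + y) /\<^sub>R 2) powr r \<le> (norm x powr r + norm y powr r) / 2"
      using mid[of x y] powr_midpoint_le[OF r norm_ge_zero norm_ge_zero, of x y] by linarith
    then show ?thesis using r by (simp add: field_simps)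
  qed
  have unif: "\<exists>\<delta>>0. \<forall>x y :: 'x. norm x \<le> R \<longrightarrow> norm y \<le> R \<longrightarrow>
        (norm x powr r / r + norm y powr r / r) / 2 - \<delta> \<le> norm ((x + y) /\<^sub>R 2) powr r / r \<longrightarrow> norm (x - y) < \<epsilon>"
    if e: "\<epsilon> > 0" for R \<epsilon> :: real
  proof (rule ccontr)
    assume neg: "\<not> ?thesis"
    have "\<exists>x y :: 'x. norm x \<le> R \<and> norm y \<le> R \<and>
        (norm x powr r / r + norm y powr r / r) / 2 - inverse (real (Suc n)) \<le> norm ((x + y) /\<^sub>R 2) powr r / r
        \<and> norm (x - y) \<ge> \<epsilon>" for n
      using neg by (metis inverse_positive_iff_positive not_le of_nat_0_less_iff zero_less_Suc)
    then obtain x y :: "nat \<Rightarrow> 'x" where xy: "\<And>n. norm (x n) \<le> R" "\<And>n. norm (y n) \<le> R"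
      "\<And>n. (norm (x n) powr r / r + norm (y n) powr r / r) / 2 - inverse (real (Suc n)) \<le> norm ((x n + y n) /\<^sub>R 2) powr r / r"
      "\<And>n. norm (x n - y n) \<ge> \<epsilon>"
      by metis
    have "bounded (range (\<lambda>n. (norm (x n), norm (y n))))"
      by (rule bounded_subset[of "cball 0 R \<times> cball 0 R"]) (use xy in \<open>auto intro: bounded_Times\<close>)
    then obtain \<rho>\<sigma> f where f: "strict_mono (f :: nat \<Rightarrow> nat)"
      "((\<lambda>n. (norm (x n), norm (y n))) \<circ> f) \<longlonglongrightarrow> \<rho>\<sigma>"
      using bounded_imp_convergent_subsequence by blast
    define \<rho> \<sigma> where "\<rho> = fst \<rho>\<sigma>" and "\<sigma> = snd \<rho>\<sigma>"
    have X: "(\<lambda>n. norm (x (f n))) \<longlonglongrightarrow> \<rho>" and Y: "(\<lambda>n. norm (y (f n))) \<longlonglongrightarrow> \<sigma>"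
      using tendsto_fst[OF f(2)] tendsto_snd[OF f(2)] by (simp_all add: \<rho>_def \<sigma>_def o_def)
    have nn: "\<rho> \<ge> 0" "\<sigma> \<ge> 0" using LIMSEQ_le_const[OF X, of 0] LIMSEQ_le_const[OF Y, of 0] by auto
    define l where "l n = (norm (x n) powr r + norm (y n) powr r) / 2 - r * inverse (real (Suc n))" for n
    have l_le: "l n \<le> norm ((x n + y n) /\<^sub>R 2) powr r" for n
    proof -
      have "(a + b) / 2 - r * e \<le> c" if "(a / r + b / r) / 2 - e \<le> c / r" for a b c e
        using mult_left_mono[OF that, of r] r by (simp add: right_diff_distrib distrib_left add_divide_distrib)
      then show ?thesis unfolding l_def using xy(3)[of n] by blast
    qed
    have pX: "(\<lambda>n. norm (x (f n)) powr r) \<longlonglongrightarrow> \<rho> powr r" and pY: "(\<lambda>n. norm (y (f n)) powr r) \<longlonglongrightarrow> \<sigma> powr r"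
      using r by (auto intro!: tendsto_powr' X Y)
    have "(\<lambda>n. inverse (real (Suc (f n)))) \<longlonglongrightarrow> 0"
      using LIMSEQ_subseq_LIMSEQ[OF LIMSEQ_inverse_real_of_nat f(1)] by (simp add: o_def)
    then have "(\<lambda>n. l (f n)) \<longlonglongrightarrow> (\<rho> powr r + \<sigma> powr r) / 2 - r * 0"
      unfolding l_def by (intro tendsto_intros pX pY) auto
    then have L: "(\<lambda>n. l (f n)) \<longlonglongrightarrow> (\<rho> powr r + \<sigma> powr r) / 2" by simp
    have U: "(\<lambda>n. ((norm (x (f n)) + norm (y (f n))) / 2) powr r) \<longlonglongrightarrow> ((\<rho> + \<sigma>) / 2) powr r"
      using r by (intro tendsto_powr' tendsto_intros X Y) auto
    have "(\<rho> powr r + \<sigma> powr r) / 2 \<le> ((\<rho> + \<sigma>) / 2) powr r"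
      by (intro LIMSEQ_le[OF L U] exI[of _ 0] allI impI order_trans[OF l_le mid])
    then have eq: "\<rho> = \<sigma>" by (rule powr_midpoint_eqD[OF r nn])
    have M: "(\<lambda>n. norm ((x (f n) + y (f n)) /\<^sub>R 2) powr r) \<longlonglongrightarrow> \<rho> powr r"
    proof (rule tendsto_sandwich)
      show "(\<lambda>n. l (f n)) \<longlonglongrightarrow> \<rho> powr r" using L eq by simp
      show "(\<lambda>n. ((norm (x (f n)) + norm (y (f n))) / 2) powr r) \<longlonglongrightarrow> \<rho> powr r" using U eq by simp
    qed (intro always_eventually allI l_le mid)+
    have "(\<lambda>n. (norm ((x (f n) + y (f n)) /\<^sub>R 2) powr r) powr (1 / r)) \<longlonglongrightarrow> (\<rho> powr r) powr (1 / r)"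
      using r by (intro tendsto_powr' M) auto
    then have "(\<lambda>n. 2 * norm ((x (f n) + y (f n)) /\<^sub>R 2)) \<longlonglongrightarrow> 2 * \<rho>"
      using r nn by (intro tendsto_intros) (simp add: powr_powr)
    then have "(\<lambda>n. norm (x (f n) + y (f n))) \<longlonglongrightarrow> 2 * \<rho>" by simp
    then have "(\<lambda>n. x (f n) - y (f n)) \<longlonglongrightarrow> 0"
      using X Y eq by (intro uniformly_convex_seq[OF uc]) auto
    then have "(\<lambda>n. norm (x (f n) - y (f n))) \<longlonglongrightarrow> 0" by (rule tendsto_norm_zero)
    then have "\<epsilon> \<le> 0" by (rule LIMSEQ_le_const) (use xy in auto)
    then show False using e by simp
  qed
  show ?thesis unfolding uniformly_convex_on_bounded_def
    by (intro conjI allI impI cvx) (rule unif)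
qed

text \<open>Each component has a nonnegative convexity gap, so a small total gap bounds
  both.\<close>

lemma uniformly_convex_on_bounded_prod:
  fixes g :: "'x::real_normed_vector \<Rightarrow> real" and h :: "'y::real_normed_vector \<Rightarrow> real"
  assumes g: "uniformly_convex_on_bounded g" and h: "uniformly_convex_on_bounded h"
  shows "uniformly_convex_on_bounded (\<lambda>z. g (fst z) + h (snd z))"
proof -
  have cg: "g ((x + y) /\<^sub>R 2) \<le> (g x + g y) / 2" for x y
    using g unfolding uniformly_convex_on_bounded_def by blast
  have ch: "h ((x + y) /\<^sub>R 2) \<le> (h x + h y) / 2" for x y
    using h unfolding uniformly_convex_on_bounded_def by blast
  have unif: "\<exists>\<delta>>0. \<forall>x y. norm x \<le> R \<longrightarrow> norm y \<le> R \<longrightarrow>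
        (g (fst x) + h (snd x) + (g (fst y) + h (snd y))) / 2 - \<delta>
          \<le> g (fst ((x + y) /\<^sub>R 2)) + h (snd ((x + y) /\<^sub>R 2)) \<longrightarrow> norm (x - y) < \<epsilon>"
    if e: "\<epsilon> > 0" for R \<epsilon> :: real
  proof -
    obtain \<delta>1 where d1: "\<delta>1 > 0" "\<And>x y. norm x \<le> R \<Longrightarrow> norm y \<le> R \<Longrightarrow>
        (g x + g y) / 2 - \<delta>1 \<le> g ((x + y) /\<^sub>R 2) \<Longrightarrow> norm (x - y) < \<epsilon> / 2"
      using g half_gt_zero[OF e] unfolding uniformly_convex_on_bounded_def by meson
    obtain \<delta>2 where d2: "\<delta>2 > 0" "\<And>x y. norm x \<le> R \<Longrightarrow> norm y \<le> R \<Longrightarrow>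
        (h x + h y) / 2 - \<delta>2 \<le> h ((x + y) /\<^sub>R 2) \<Longrightarrow> norm (x - y) < \<epsilon> / 2"
      using h half_gt_zero[OF e] unfolding uniformly_convex_on_bounded_def by meson
    show ?thesis
    proof (intro exI[of _ "min \<delta>1 \<delta>2"] conjI allI impI)
      fix x y :: "'x \<times> 'y"
      assume n: "norm x \<le> R" "norm y \<le> R"
        and le: "(g (fst x) + h (snd x) + (g (fst y) + h (snd y))) / 2 - min \<delta>1 \<delta>2
          \<le> g (fst ((x + y) /\<^sub>R 2)) + h (snd ((x + y) /\<^sub>R 2))"
      have "norm (fst x) \<le> R" "norm (fst y) \<le> R" "norm (snd x) \<le> R" "norm (snd y) \<le> R"
        using n norm_fst_le[of "fst x" "snd x"] norm_fst_le[of "fst y" "snd y"]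
          norm_snd_le[of "snd x" "fst x"] norm_snd_le[of "snd y" "fst y"] by simp_all
      moreover have "(g (fst x) + g (fst y)) / 2 - \<delta>1 \<le> g ((fst x + fst y) /\<^sub>R 2)"
        using le ch[of "snd x" "snd y"] by (simp add: add_divide_distrib)
      moreover have "(h (snd x) + h (snd y)) / 2 - \<delta>2 \<le> h ((snd x + snd y) /\<^sub>R 2)"
        using le cg[of "fst x" "fst y"] by (simp add: add_divide_distrib)
      ultimately have "norm (fst (x - y)) < \<epsilon> / 2" "norm (snd (x - y)) < \<epsilon> / 2"
        using d1 d2 by simp_all
      then show "norm (x - y) < \<epsilon>"
        using norm_Pair_le[of "fst (x - y)" "snd (x - y)"] unfolding prod.collapse by linarith
    qed (use d1 d2 in auto)
  qed
  then show ?thesis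
    unfolding uniformly_convex_on_bounded_def
  proof (intro conjI allI impI)
    show "g (fst ((x + y) /\<^sub>R 2)) + h (snd ((x + y) /\<^sub>R 2))
        \<le> (g (fst x) + h (snd x) + (g (fst y) + h (snd y))) / 2" for x y
      using cg[of "fst x" "fst y"] ch[of "snd x" "snd y"] by (simp add: add_divide_distrib)
  qed (rule unif)
qed

text \<open>The midpoint of two near-minimisers stays in \<open>C\<close>, so its value is at least
  the infimum; the convexity gap of \<open>g\<close> between them is then small and the sequence is
  Cauchy. The heights converge too, because the values \<open>s n + g (x n)\<close> and
  \<open>g (x n)\<close> do.\<close>

lemma convex_minimizer_exists:
  fixes g :: "'x::banach \<Rightarrow> real"
  assumes g: "uniformly_convex_on_bounded g" and cont: "continuous_on UNIV g"
    and C: "closed C" "convex C" "C \<noteq> {}"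
    and bdd: "\<And>x s. (x, s) \<in> C \<Longrightarrow> m \<le> s + g x"
    and coercive: "\<And>c. \<exists>R. \<forall>(x, s)\<in>C. s + g x \<le> c \<longrightarrow> norm x \<le> R"
  obtains x0 s0 where "(x0, s0) \<in> C" "\<And>x s. (x, s) \<in> C \<Longrightarrow> s0 + g x0 \<le> s + g x"
proof -
  define H where "H = (\<lambda>(x, s). s + g x)"
  define I where "I = Inf (H ` C)"
  have I_le: "I \<le> s + g x" if "(x, s) \<in> C" for x s
    unfolding I_def using that bdd
    by (intro cInf_lower) (auto simp: H_def intro!: bdd_belowI[of _ m] image_eqI[of _ _ "(x, s)"])
  have "\<exists>z\<in>C. H z < I + inverse (real (Suc n))" for n
  proof -
    have "\<exists>h\<in>H ` C. h < I + inverse (real (Suc n))"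
      unfolding I_def using C(3) by (intro cInf_lessD) auto
    then show ?thesis by blast
  qed
  then obtain z where z: "\<And>n. z n \<in> C" "\<And>n. H (z n) < I + inverse (real (Suc n))" by metis
  define x where "x n = fst (z n)" for n
  define s where "s n = snd (z n)" for n
  have xs: "(x n, s n) \<in> C" "s n + g (x n) < I + inverse (real (Suc n))" for n
    using z[of n] by (auto simp: x_def s_def H_def split_beta)
  obtain R where R: "\<And>x s. (x, s) \<in> C \<Longrightarrow> s + g x \<le> I + 1 \<Longrightarrow> norm x \<le> R"
    using coercive[of "I + 1"] by blast
  have "inverse (real (Suc n)) \<le> 1" for n by (simp add: field_simps)
  then have nx: "norm (x n) \<le> R" for n
    using R[OF xs(1)[of n]] xs(2)[of n] by (smt (verit))
  have "Cauchy x"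
  proof (rule metric_CauchyI)
    fix \<epsilon> :: real assume "\<epsilon> > 0"
    then obtain \<delta> where d: "\<delta> > 0" "\<And>x y. norm x \<le> R \<Longrightarrow> norm y \<le> R \<Longrightarrow>
        (g x + g y) / 2 - \<delta> \<le> g ((x + y) /\<^sub>R 2) \<Longrightarrow> norm (x - y) < \<epsilon>"
      using g unfolding uniformly_convex_on_bounded_def by meson
    obtain N where N: "inverse (real (Suc N)) < \<delta>" using reals_Archimedean[OF d(1)] by blast
    have "dist (x i) (x j) < \<epsilon>" if ij: "i \<ge> N" "j \<ge> N" for i j
    proof -
      have sm: "inverse (real (Suc k)) < \<delta>" if "k \<ge> N" for k
      proof -
        have "inverse (real (Suc k)) \<le> inverse (real (Suc N))" using that by (intro le_imp_inverse_le) auto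
        then show ?thesis using N by linarith
      qed
      have "((x i + x j) /\<^sub>R 2, (s i + s j) / 2) \<in> C"
        using convexD[OF C(2) xs(1)[of i] xs(1)[of j], of "1/2" "1/2"]
        by (simp add: scaleR_add_right inverse_eq_divide add_divide_distrib)
      then have "I \<le> (s i + s j) / 2 + g ((x i + x j) /\<^sub>R 2)" by (rule I_le)
      moreover have "s i + g (x i) < I + \<delta>" "s j + g (x j) < I + \<delta>"
        using xs(2)[of i] xs(2)[of j] sm ij by (smt (verit))+
      ultimately have "(g (x i) + g (x j)) / 2 - \<delta> \<le> g ((x i + x j) /\<^sub>R 2)"
        by (simp add: add_divide_distrib)
      then show ?thesis using d(2)[OF nx nx] by (simp add: dist_norm)
    qed
    then show "\<exists>M. \<forall>m\<ge>M. \<forall>n\<ge>M. dist (x m) (x n) < \<epsilon>" by blast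
  qed
  then obtain x0 where x0: "x \<longlonglongrightarrow> x0" using Cauchy_convergent_iff convergent_def by blast
  have gx: "(\<lambda>n. g (x n)) \<longlonglongrightarrow> g x0"
    using continuous_on_tendsto_compose[OF cont x0] by simp
  have "(\<lambda>n. s n + g (x n)) \<longlonglongrightarrow> I"
  proof (rule tendsto_sandwich)
    show "\<forall>\<^sub>F n in sequentially. I \<le> s n + g (x n)" using I_le xs(1) by simp
    show "\<forall>\<^sub>F n in sequentially. s n + g (x n) \<le> I + inverse (real (Suc n))"
      using xs(2) by (simp add: less_imp_le)
    show "(\<lambda>n. I + inverse (real (Suc n))) \<longlonglongrightarrow> I" by (rule LIMSEQ_inverse_real_of_nat_add)
  qed simp
  from tendsto_diff[OF this gx] have s0: "s \<longlonglongrightarrow> I - g x0" by simp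
  have "(x0, I - g x0) \<in> C"
    using closed_sequentially[OF C(1) xs(1) tendsto_Pair[OF x0 s0]] .
  then show ?thesis using that[of x0 "I - g x0"] I_le by simp
qed

text \<open>A step of length \<open>inverse (real (Suc n))\<close> towards \<open>(x, s)\<close>
  stays in \<open>C\<close> and changes the height linearly; dividing by the step leaves
  \<open>s0 - s \<le> d n\<close>. Upper bounds on difference quotients thus stand in for a
  derivative of \<open>g\<close>.\<close>

lemma convex_minimizer_variational:
  fixes g :: "'x::real_normed_vector \<Rightarrow> real"
  assumes C: "convex C" "(x0, s0) \<in> C" and minim: "\<And>x s. (x, s) \<in> C \<Longrightarrow> s0 + g x0 \<le> s + g x"
    and x: "(x, s) \<in> C"
    and up: "\<And>n. g (x0 + inverse (real (Suc n)) *\<^sub>R (x - x0)) \<le> g x0 + inverse (real (Suc n)) * d n"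
    and d: "d \<longlonglongrightarrow> D"
  shows "s0 \<le> s + D"
proof -
  have "s0 - s \<le> d n" for n
  proof -
    define l where "l = inverse (real (Suc n))"
    have l: "0 < l" "l \<le> 1" by (auto simp: l_def field_simps)
    have "(1 - l) *\<^sub>R (x0, s0) + l *\<^sub>R (x, s) \<in> C"
      using l by (intro convexD[OF C(1) C(2) x]) auto
    then have "(x0 + l *\<^sub>R (x - x0), (1 - l) * s0 + l * s) \<in> C"
      by (simp add: algebra_simps)
    from minim[OF this] have "s0 + g x0 \<le> (1 - l) * s0 + l * s + (g x0 + l * d n)"
      using up[of n] by (simp add: l_def)
    then have "l * (s0 - s) \<le> l * d n" by (simp add: algebra_simps)
    then show ?thesis using l by simp
  qed
  then have "s0 - s \<le> D" using d by (intro LIMSEQ_le_const) auto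
  then show ?thesis by simp
qed

subsection \<open>Duality mappings\<close>

text \<open>The pairing is abstract so that one theory serves both the map from the space to its
  dual and the map from the dual back to the space, with no bidual in sight.\<close>

locale duality_pair =
  fixes B :: "'x::real_normed_vector \<Rightarrow> 'y::real_normed_vector \<Rightarrow> real"
    and J :: "'x \<Rightarrow> 'y" and r :: real
  assumes bilinear: "bounded_bilinear B"
    and B_le: "\<And>x y. B x y \<le> norm x * norm y"
    and r: "r > 1"
    and B_J: "\<And>x. B x (J x) = norm x * norm (J x)"
    and norm_J: "\<And>x. norm (J x) = norm x powr (r - 1)"
    and X_uc: "uniformly_convex TYPE('x)"
    and Y_uc: "uniformly_convex TYPE('y)"
begin

lemmas B_simps =
  bounded_bilinear.add_left[OF bilinear] bounded_bilinear.add_right[OF bilinear]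
  bounded_bilinear.diff_left[OF bilinear] bounded_bilinear.diff_right[OF bilinear]
  bounded_bilinear.minus_left[OF bilinear] bounded_bilinear.minus_right[OF bilinear]
  bounded_bilinear.scaleR_left[OF bilinear] bounded_bilinear.scaleR_right[OF bilinear]

lemma norm_powr_split: "norm x * norm x powr (r - 1) = norm x powr r"
  using powr_mult_base[of "norm x" "r - 1"] by simp

lemma B_J_powr: "B x (J x) = norm x powr r"
  by (simp add: B_J norm_J norm_powr_split)

lemma B_J_le: "B y (J x) \<le> norm y * norm x powr (r - 1)"
  using B_le[of y "J x"] by (simp add: norm_J)

lemma J_eqI:
  assumes "B x y = norm x * norm y" "norm y = norm x powr (r - 1)"
  shows "y = J x"
proof (cases "x = 0")
  case True
  then show ?thesis using assms norm_J[of x] by simp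
next
  case False
  have "norm x * (2 * norm x powr (r - 1)) \<le> norm x * norm (y + J x)"
    using B_le[of x "y + J x"] assms by (simp add: B_simps B_J norm_J)
  then have "2 * norm x powr (r - 1) \<le> norm (y + J x)" using False by simp
  then show ?thesis
    by (rule uniformly_convex_strict[OF Y_uc assms(2) norm_J])
qed

lemma J_subgradient: "norm x powr r / r + B (y - x) (J x) \<le> norm y powr r / r"
proof -
  have "norm x powr r + r * norm x powr (r - 1) * (norm y - norm x) \<le> norm y powr r"
    using r by (intro powr_ge_tangent) auto
  moreover have "B (y - x) (J x) \<le> norm x powr (r - 1) * (norm y - norm x)"
    using B_J_le[of y x] B_J_powr[of x] norm_powr_split[of x] by (simp add: B_simps algebra_simps)
  then have "r * B (y - x) (J x) \<le> r * (norm x powr (r - 1) * (norm y - norm x))"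
    using r by simp
  ultimately have "norm x powr r + r * B (y - x) (J x) \<le> norm y powr r" by (simp add: mult.assoc)
  then show ?thesis using r by (simp add: pos_le_divide_eq mult.commute[of _ r] distrib_left)
qed

text \<open>The subgradient inequality based at the moved point and tested at \<open>x\<close>
  bounds the increment from above; with \<open>J_tendsto\<close> this replaces differentiability of
  the norm.\<close>

lemma J_directional:
  "norm (x + l *\<^sub>R h) powr r / r \<le> norm x powr r / r + l * B h (J (x + l *\<^sub>R h))"
  using J_subgradient[of "x + l *\<^sub>R h" x] by (simp add: B_simps)

text \<open>Unequal norms contradict the sum of the two strict tangent inequalities for the scalar
  power. With equal norms \<open>a > 0\<close>, \<open>J x\<close> nearly norms both vectors, in
  fact exactly, so \<open>norm (x + y) \<ge> 2 * a\<close> and strict convexity applies.\<close>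

lemma J_strictly_monotone:
  assumes le: "B (x - y) (J x - J y) \<le> 0"
  shows "x = y"
proof -
  define a b where "a = norm x" and "b = norm y"
  have nn: "a \<ge> 0" "b \<ge> 0" by (simp_all add: a_def b_def)
  have sum: "a powr r + b powr r \<le> B x (J y) + B y (J x)"
    using le by (simp add: B_simps B_J_powr a_def b_def)
  have le1: "B x (J y) \<le> a * b powr (r - 1)" and le2: "B y (J x) \<le> b * a powr (r - 1)"
    unfolding a_def b_def by (rule B_J_le)+
  have split: "a * a powr (r - 1) = a powr r" "b * b powr (r - 1) = b powr r"
    unfolding a_def b_def by (rule norm_powr_split)+
  have eq: "a = b"
  proof (rule ccontr)
    assume ne: "a \<noteq> b"
    have "a powr r + r * a powr (r - 1) * (b - a) < b powr r"
      and "b powr r + r * b powr (r - 1) * (a - b) < a powr r"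
      using powr_above_tangent[OF r] nn ne by blast+
    then have "r * (a powr (r - 1) * (b - a) + b powr (r - 1) * (a - b)) < 0"
      by (simp add: distrib_left mult.assoc)
    then have "a powr (r - 1) * (b - a) + b powr (r - 1) * (a - b) < 0"
      using r by (simp add: mult_less_0_iff)
    then show False using sum le1 le2 split by (simp add: algebra_simps)
  qed
  show ?thesis
  proof (cases "a = 0")
    case True
    then show ?thesis using eq by (simp add: a_def b_def)
  next
    case False
    have "B y (J x) \<ge> a powr r" using sum le1 eq split by simp
    then have "2 * a powr r \<le> B (x + y) (J x)" by (simp add: B_simps B_J_powr a_def)
    also have "\<dots> \<le> norm (x + y) * a powr (r - 1)" unfolding a_def by (rule B_J_le)
    finally have "2 * a * a powr (r - 1) \<le> norm (x + y) * a powr (r - 1)" using split by simp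
    then have "2 * a \<le> norm (x + y)" using False nn by simp
    then show ?thesis
      using uniformly_convex_strict[OF X_uc, of x a y] eq by (simp add: a_def b_def)
  qed
qed

text \<open>Minty's argument: solve \<open>J z + P z = J x + y\<close>. Monotonicity against
  \<open>z\<close> makes the pairing of \<open>x - z\<close> with \<open>J x - J z\<close>
  nonpositive, hence \<open>x = z\<close>.\<close>

lemma surjective_imp_maximal:
  assumes surj: "range (\<lambda>x. J x + P x) = UNIV" and mono: "\<And>z. 0 \<le> B (x - z) (y - P z)"
  shows "y = P x"
proof -
  have "J x + y \<in> range (\<lambda>x. J x + P x)" using surj by simp
  then obtain z where z: "J x + y = J z + P z" by blast
  then have "y - P z = - (J x - J z)" by (simp add: algebra_simps)
  then have "x = z" using mono[of z] by (intro J_strictly_monotone) (simp add: B_simps)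
  then show ?thesis using z by simp
qed

text \<open>Young's inequality for \<open>x\<close> and \<open>- y\<close>; the sign is chosen
  because the equation wanted at the minimiser reads \<open>J u = - a\<close>.\<close>

lemma Fenchel_Young:
  assumes r': "r' > 1" "1 / r + 1 / r' = 1"
  shows "0 \<le> B x y + (norm x powr r / r + norm y powr r' / r')"
    and "B x y + (norm x powr r / r + norm y powr r' / r') \<le> 0 \<Longrightarrow> J x = - y"
proof -
  have le: "- B x y \<le> norm x * norm y" using B_le[of x "- y"] by (simp add: B_simps)
  note Young = Young_powr[OF r r' norm_ge_zero norm_ge_zero, of x y]
  show "0 \<le> B x y + (norm x powr r / r + norm y powr r' / r')"
    using le Young(1) by linarith
  assume "B x y + (norm x powr r / r + norm y powr r' / r') \<le> 0"
  then have "norm x * norm y = norm x powr r / r + norm y powr r' / r'" "- B x y = norm x * norm y"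
    using le Young(1) by linarith+
  then show "J x = - y" using Young(2) J_eqI[of x "- y"] by (simp add: B_simps)
qed

text \<open>Pairing \<open>J (z n) + J x\<close> with \<open>x\<close> shows that its norm is
  asymptotically at least \<open>2 * norm x powr (r - 1)\<close>, and uniform convexity of the
  target space applies.\<close>

lemma J_tendsto:
  assumes z: "z \<longlonglongrightarrow> x"
  shows "(\<lambda>n::nat. J (z n)) \<longlonglongrightarrow> J x"
proof -
  have nz: "(\<lambda>n. norm (z n)) \<longlonglongrightarrow> norm x" by (intro tendsto_norm z)
  have nJ: "(\<lambda>n. norm (J (z n))) \<longlonglongrightarrow> norm x powr (r - 1)"
    unfolding norm_J using r by (intro tendsto_powr' nz tendsto_const) auto
  show ?thesis
  proof (cases "x = 0")
    case True
    then have "(\<lambda>n. J (z n)) \<longlonglongrightarrow> 0" using nJ by (simp add: tendsto_norm_zero_iff)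
    moreover have "J x = 0" using True norm_J[of x] by simp
    ultimately show ?thesis by simp
  next
    case False
    define l where
      "l n = (norm (z n) * norm (J (z n)) - norm (z n - x) * norm (J (z n)) + norm x * norm x powr (r - 1)) / norm x" for n
    have "(\<lambda>n. norm (z n - x)) \<longlonglongrightarrow> 0"
      using z by (simp add: tendsto_norm_zero LIM_zero)
    then have "l \<longlonglongrightarrow> (norm x * norm x powr (r - 1) - 0 * norm x powr (r - 1) + norm x * norm x powr (r - 1)) / norm x"
      unfolding l_def using False by (intro tendsto_intros nz nJ) auto
    then have l: "l \<longlonglongrightarrow> 2 * norm x powr (r - 1)" using False by (simp add: field_simps)
    have "l n \<le> norm (J (z n) + J x)" for n
    proof -
      have "norm (z n) * norm (J (z n)) - norm (z n - x) * norm (J (z n)) + norm x * norm x powr (r - 1)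
          \<le> B (z n) (J (z n)) - B (z n - x) (J (z n)) + B x (J x)"
        using B_le[of "z n - x" "J (z n)"] by (simp add: B_J norm_J)
      also have "\<dots> = B x (J (z n) + J x)" by (simp add: B_simps)
      also have "\<dots> \<le> norm (J (z n) + J x) * norm x" using B_le by (simp add: mult.commute)
      finally show ?thesis unfolding l_def using False by (simp add: pos_divide_le_eq)
    qed
    then have "(\<lambda>n. J (z n) - J x) \<longlonglongrightarrow> 0"
      by (intro uniformly_convex_seq[OF Y_uc nJ _ _ l]) (simp_all add: norm_J)
    then show ?thesis by (rule LIM_zero_cancel)
  qed
qed

end

section \<open>Norm attainment and uniform convexity of the dual\<close>

lemma blinfun_near_norm:
  fixes f :: "'x::real_normed_vector dual"
  assumes "f \<noteq> 0" "e > 0"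
  obtains x where "norm x = 1" "norm f - e < blinfun_apply f x"
proof -
  have "\<exists>x. norm x = 1 \<and> norm f - e < blinfun_apply f x"
  proof (rule ccontr)
    assume "\<not> ?thesis"
    then have le: "blinfun_apply f x \<le> norm f - e" if "norm x = 1" for x using that by force
    have sgn_le: "blinfun_apply f x \<le> (norm f - e) * norm x" for x
    proof (cases "x = 0")
      case False
      then have "blinfun_apply f (sgn x) \<le> norm f - e" by (intro le) (simp add: norm_sgn)
      then show ?thesis using False
        by (simp add: sgn_div_norm blinfun.scaleR_right field_simps)
    qed (simp add: blinfun.zero_right)
    have bd: "norm (blinfun_apply f x) \<le> (norm f - e) * norm x" for x
      using sgn_le[of x] sgn_le[of "- x"] by (simp add: blinfun.minus_right)
    \<comment> \<open>The operator norm bound requires a nonnegative constant; a point where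
      \<open>f\<close> does not vanish shows that \<open>norm f - e\<close> is one.\<close>
    obtain x where "blinfun_apply f x \<noteq> 0"
      using assms(1) by (metis blinfun_eqI blinfun.zero_left)
    then have "x \<noteq> 0" "0 < (norm f - e) * norm x"
      using bd[of x] by (auto simp: blinfun.zero_right)
    then have "0 \<le> norm f - e" by (simp add: zero_less_mult_iff)
    then have "norm f \<le> norm f - e" by (rule norm_blinfun_bound) (rule bd)
    then show False using assms by simp
  qed
  then show ?thesis using that by blast
qed

text \<open>For two nearly norming unit vectors, \<open>f\<close> is close to
  \<open>2 * norm f\<close> at their sum, so the sum has norm close to 2. Maximising sequences are
  therefore Cauchy.\<close>

lemma norm_attained:
  fixes f :: "'x::banach dual"
  assumes uc: "uniformly_convex TYPE('x)" and f: "f \<noteq> 0"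
  obtains x where "norm x = 1" "blinfun_apply f x = norm f"
proof -
  have pos: "norm f > 0" using f by simp
  have f_le: "blinfun_apply f x \<le> norm f * norm x" for x
    using norm_blinfun[of f x] by simp
  have "\<exists>x. norm x = 1 \<and> norm f - inverse (real (Suc n)) < blinfun_apply f x" for n
    using blinfun_near_norm[OF f, of "inverse (real (Suc n))"] by (metis inverse_positive_iff_positive of_nat_0_less_iff zero_less_Suc)
  then obtain x where x: "\<And>n. norm (x n) = 1" "\<And>n. norm f - inverse (real (Suc n)) < blinfun_apply f (x n)"
    by metis
  have "Cauchy x"
  proof (rule metric_CauchyI)
    fix \<epsilon> :: real assume "\<epsilon> > 0"
    then obtain \<delta> where d: "\<delta> > 0" "\<And>x y :: 'x. norm x \<le> 1 \<Longrightarrow> norm y \<le> 1 \<Longrightarrow> norm (x + y) \<ge> 2 - \<delta> \<Longrightarrow> norm (x - y) < \<epsilon>"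
      using uniformly_convex_unit_ball[OF uc] by metis
    have "0 < \<delta> * norm f / 2" using d pos by simp
    then obtain N where N: "inverse (real (Suc N)) < \<delta> * norm f / 2" using reals_Archimedean by blast
    have "dist (x i) (x j) < \<epsilon>" if ij: "i \<ge> N" "j \<ge> N" for i j
    proof -
      have near: "norm f - \<delta> * norm f / 2 < blinfun_apply f (x k)" if "k \<ge> N" for k
      proof -
        have "inverse (real (Suc k)) \<le> inverse (real (Suc N))" using that by (intro le_imp_inverse_le) auto
        then show ?thesis using N x(2)[of k] by linarith
      qed
      have "norm f * (2 - \<delta>) \<le> blinfun_apply f (x i + x j)"
        using near[OF ij(1)] near[OF ij(2)] by (simp add: blinfun.add_right algebra_simps)
      also have "\<dots> \<le> norm f * norm (x i + x j)" by (rule f_le)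
      finally have "2 - \<delta> \<le> norm (x i + x j)" using pos by simp
      then show ?thesis using d(2)[of "x i" "x j"] x(1) by (simp add: dist_norm)
    qed
    then show "\<exists>M. \<forall>m\<ge>M. \<forall>n\<ge>M. dist (x m) (x n) < \<epsilon>" by blast
  qed
  then obtain x0 where x0: "x \<longlonglongrightarrow> x0" using Cauchy_convergent_iff convergent_def by blast
  have "norm x0 = 1"
    using LIMSEQ_unique[OF tendsto_norm[OF x0]] x(1) by simp
  moreover have "norm f \<le> blinfun_apply f x0"
  proof (rule LIMSEQ_le)
    show "(\<lambda>n. norm f - inverse (real (Suc n))) \<longlonglongrightarrow> norm f"
      using tendsto_diff[OF tendsto_const LIMSEQ_inverse_real_of_nat, of "norm f"] by simp
    show "(\<lambda>n. blinfun_apply f (x n)) \<longlonglongrightarrow> blinfun_apply f x0"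
      by (rule bounded_linear.tendsto[OF blinfun.bounded_linear_right x0])
  qed (use x(2) less_imp_le in blast)
  ultimately show ?thesis using that[of x0] f_le[of x0] by simp
qed

text \<open>Let \<open>x\<close> nearly norm \<open>f + g\<close> and \<open>z\<close> nearly norm
  \<open>f - g\<close>. Evaluating \<open>f\<close> at \<open>x + \<delta> *\<^sub>R z\<close> and
  \<open>g\<close> at \<open>x - \<delta> *\<^sub>R z\<close>, smoothness at \<open>x\<close> limits
  how large \<open>norm (f + g)\<close> can be when \<open>f - g\<close> is not small.\<close>

lemma uniformly_convex_dual:
  assumes us: "uniformly_smooth TYPE('x::real_normed_vector)"
  shows "uniformly_convex TYPE('x dual)"
  unfolding uniformly_convex_def
proof (intro allI impI)
  fix \<epsilon> :: real assume e: "0 < \<epsilon> \<and> \<epsilon> \<le> 2"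
  then have "\<epsilon> / 4 > 0" by simp
  then obtain \<delta> where d: "\<delta> > 0" "\<And>x y :: 'x. norm x = 1 \<Longrightarrow> norm y \<le> \<delta> \<Longrightarrow>
      norm (x + y) + norm (x - y) \<le> 2 + \<epsilon> / 4 * norm y"
    using us unfolding uniformly_smooth_def by metis
  \<comment> \<open>The gain \<open>\<delta> * (\<epsilon> / 2)\<close> from \<open>f - g\<close>
    exceeds the smoothness error \<open>\<delta> * (\<epsilon> / 4)\<close> by exactly \<kappa>. The
    cap 1 in \<open>min 1 (\<kappa> / 2)\<close> serves the case \<open>f + g = 0\<close>.\<close>
  define \<kappa> where "\<kappa> = \<epsilon> * \<delta> / 4"
  have k: "\<kappa> > 0" using e d by (simp add: \<kappa>_def)
  have main: "norm ((f + g) /\<^sub>R 2) \<le> 1 - min 1 (\<kappa> / 2)"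
    if f: "norm f = 1" and g: "norm g = 1" and fg: "norm (f - g) \<ge> \<epsilon>" for f g :: "'x dual"
  proof (cases "f + g = 0")
    case False
    have "norm (f + g) \<le> 2 - \<kappa>"
    proof (rule ccontr)
      assume "\<not> ?thesis"
      then obtain x where x: "norm x = 1" "2 - \<kappa> < blinfun_apply (f + g) x"
        using blinfun_near_norm[OF False, of "norm (f + g) - (2 - \<kappa>)"] by auto
      have "f - g \<noteq> 0" "\<epsilon> / 2 > 0" using fg e by auto
      then obtain z where z: "norm z = 1" "norm (f - g) - \<epsilon> / 2 < blinfun_apply (f - g) z"
        using blinfun_near_norm by blast
      have bd: "blinfun_apply h y \<le> norm y" if "norm h = 1" for h :: "'x dual" and y
        using norm_blinfun[of h y] that by simp
      have "\<delta> * (\<epsilon> / 2) < \<delta> * blinfun_apply (f - g) z"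
        using z fg d by (intro mult_strict_left_mono) auto
      then have "blinfun_apply (f + g) x
          < blinfun_apply f (x + \<delta> *\<^sub>R z) + blinfun_apply g (x - \<delta> *\<^sub>R z) - \<delta> * (\<epsilon> / 2)"
        by (simp add: blinfun.bilinear_simps algebra_simps)
      also have "\<dots> \<le> norm (x + \<delta> *\<^sub>R z) + norm (x - \<delta> *\<^sub>R z) - \<delta> * (\<epsilon> / 2)"
        using bd[OF f] bd[OF g] by (simp add: add_mono)
      also have "\<dots> \<le> 2 - \<kappa>"
        using d(2)[of x "\<delta> *\<^sub>R z"] x(1) z(1) d(1) by (simp add: \<kappa>_def algebra_simps)
      finally show False using x(2) by simp
    qed
    then show ?thesis by simp
  qed simp
  show "\<exists>\<delta>>0. \<forall>f g :: 'x dual. norm f = 1 \<and> norm g = 1 \<and> norm (f - g) \<ge> \<epsilon> \<longrightarrow>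
      norm ((f + g) /\<^sub>R 2) \<le> 1 - \<delta>"
    using k main by (intro exI[of _ "min 1 (\<kappa> / 2)"]) auto
qed

subsection \<open>Supporting functionals and reflexivity\<close>

text \<open>The functional is the one-sided derivative of the norm at \<open>x\<close>; smoothness makes this
  sublinear map linear, so that the Hahn-Banach theorem is not needed.\<close>

lemma smooth_supporting_functional:
  fixes x :: "'x::real_normed_vector"
  assumes us: "uniformly_smooth TYPE('x)" and x: "norm x = 1"
  obtains f :: "'x dual" where "norm f = 1" "blinfun_apply f x = 1"
proof -
  define Q where "Q s h = (norm (x + s *\<^sub>R h) - 1) / s" for s h
  define D where "D h = Inf ((\<lambda>s. Q s h) ` {0<..})" for h
  have Q_lower: "- norm h \<le> Q s h" if "s > 0" for s h
    using norm_diff_ineq[of x "s *\<^sub>R h"] that x by (simp add: Q_def field_simps)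
  have Q_upper: "Q s h \<le> norm h" if "s > 0" for s h
    using norm_triangle_ineq[of x "s *\<^sub>R h"] that x by (simp add: Q_def field_simps)
  have D_le: "D h \<le> Q s h" if "s > 0" for s h
    unfolding D_def using that Q_lower
    by (intro cInf_lower) (auto intro!: bdd_belowI[of _ "- norm h"])
  have D_ge: "c \<le> D h" if "\<And>s. s > 0 \<Longrightarrow> c \<le> Q s h" for c h
    unfolding D_def using that by (intro cInf_greatest) auto
  have D_less: "\<exists>s>0. Q s h < c" if "D h < c" for c h
    using that cInf_lessD[of "(\<lambda>s. Q s h) ` {0<..}" c] by (auto simp: D_def)
  \<comment> \<open>By convexity of the norm the quotients decrease with the step, so quotients for
    different directions can be moved to a common smaller step.\<close>
  have Q_mono: "Q s h \<le> Q t h" if "0 < s" "s \<le> t" for s t h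
  proof -
    have "x + s *\<^sub>R h = (1 - s / t) *\<^sub>R x + (s / t) *\<^sub>R (x + t *\<^sub>R h)"
      using that by (simp add: algebra_simps)
    also have "norm \<dots> \<le> norm ((1 - s / t) *\<^sub>R x) + norm ((s / t) *\<^sub>R (x + t *\<^sub>R h))"
      by (rule norm_triangle_ineq)
    also have "\<dots> = (1 - s / t) + s / t * norm (x + t *\<^sub>R h)" using that x by simp
    finally have "norm (x + s *\<^sub>R h) - 1 \<le> s * Q t h" by (simp add: Q_def right_diff_distrib diff_divide_distrib)
    then show ?thesis using that by (simp add: Q_def[of s] pos_divide_le_eq mult.commute)
  qed
  have D_upper: "D h \<le> norm h" for h using D_le[of 1 h] Q_upper[of 1 h] by simp
  have D_add_le: "D (h + k) \<le> D h + D k" for h k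
  proof (rule field_le_epsilon)
    fix e :: real assume "e > 0"
    then obtain s t where st: "s > 0" "t > 0" "Q s h < D h + e / 2" "Q t k < D k + e / 2"
      using D_less[of h "D h + e / 2"] D_less[of k "D k + e / 2"] by auto
    define m where "m = min s t"
    have m: "m > 0" "m \<le> s" "m \<le> t" using st by (auto simp: m_def)
    have "x + (m / 2) *\<^sub>R (h + k) = ((x + m *\<^sub>R h) + (x + m *\<^sub>R k)) /\<^sub>R 2"
      by (simp add: algebra_simps flip: scaleR_2)
    then have "norm (x + (m / 2) *\<^sub>R (h + k)) \<le> (norm (x + m *\<^sub>R h) + norm (x + m *\<^sub>R k)) / 2"
      using norm_triangle_ineq[of "x + m *\<^sub>R h" "x + m *\<^sub>R k"] by simp
    then have "(2 * norm (x + (m / 2) *\<^sub>R (h + k)) - 2) / m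
        \<le> (norm (x + m *\<^sub>R h) + norm (x + m *\<^sub>R k) - 2) / m"
      using m(1) by (intro divide_right_mono) auto
    then have "Q (m / 2) (h + k) \<le> Q m h + Q m k"
      by (simp add: Q_def add_divide_distrib diff_divide_distrib right_diff_distrib mult.commute[of _ 2])
    then show "D (h + k) \<le> D h + D k + e"
      using D_le[of "m / 2" "h + k"] Q_mono[OF m(1,2), of h] Q_mono[OF m(1,3), of k] m st by simp
  qed
  have D_scale_le: "D (c *\<^sub>R h) \<le> c * D h" if c: "c > 0" for c h
  proof -
    have "D (c *\<^sub>R h) / c \<le> D h"
    proof (rule D_ge)
      fix s :: real assume s: "s > 0"
      have "D (c *\<^sub>R h) \<le> Q (s / c) (c *\<^sub>R h)" using s c by (intro D_le) simp
      also have "\<dots> = c * Q s h" using s c by (simp add: Q_def)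
      finally show "D (c *\<^sub>R h) / c \<le> Q s h" using c by (simp add: pos_divide_le_eq mult.commute)
    qed
    then show ?thesis using c by (simp add: pos_divide_le_eq mult.commute)
  qed
  have D_scale_pos: "D (c *\<^sub>R h) = c * D h" if c: "c > 0" for c h
  proof (rule antisym[OF D_scale_le[OF c]])
    have "D (inverse c *\<^sub>R (c *\<^sub>R h)) \<le> inverse c * D (c *\<^sub>R h)" using c by (intro D_scale_le) simp
    then show "c * D h \<le> D (c *\<^sub>R h)" using c by (simp add: field_simps)
  qed
  \<comment> \<open>Smoothness enters here: together with subadditivity it makes \<open>D\<close>
    odd, and an odd sublinear map is linear.\<close>
  have D_smooth: "D h + D (- h) \<le> 0" for h
  proof (rule field_le_epsilon)
    fix e :: real assume e: "e > 0"
    define \<epsilon> where "\<epsilon> = e / (norm h + 1)"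
    have \<epsilon>: "\<epsilon> > 0" "\<epsilon> * norm h \<le> e"
      using e by (auto simp: \<epsilon>_def add_pos_nonneg add_nonneg_pos field_simps)
    obtain \<delta> where d: "\<delta> > 0" "\<And>x y :: 'x. norm x = 1 \<Longrightarrow> norm y \<le> \<delta> \<Longrightarrow>
        norm (x + y) + norm (x - y) \<le> 2 + \<epsilon> * norm y"
      using us \<epsilon>(1) unfolding uniformly_smooth_def by metis
    define s where "s = \<delta> / (norm h + 1)"
    have s: "s > 0" "s * norm h \<le> \<delta>"
      using d(1) by (auto simp: s_def add_pos_nonneg add_nonneg_pos field_simps)
    have "norm (x + s *\<^sub>R h) + norm (x - s *\<^sub>R h) \<le> 2 + \<epsilon> * (s * norm h)"
      using d(2)[OF x, of "s *\<^sub>R h"] s by simp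
    then have "s * (Q s h + Q s (- h)) \<le> s * (\<epsilon> * norm h)"
      using s by (simp add: Q_def distrib_left mult_ac)
    then have "Q s h + Q s (- h) \<le> \<epsilon> * norm h" using s by simp
    then show "D h + D (- h) \<le> 0 + e" using D_le[OF s(1)] \<epsilon>(2) by (smt (verit))
  qed
  have D0: "D 0 = 0"
  proof (rule antisym)
    show "D 0 \<le> 0" using D_upper[of 0] by simp
    show "0 \<le> D 0" by (rule D_ge) (simp add: Q_def x)
  qed
  have D_minus: "D (- h) = - D h" for h
    using D_smooth[of h] D_add_le[of h "- h"] D0 by simp
  have D_add: "D (h + k) = D h + D k" for h k
    using D_add_le[of h k] D_add_le[of "- h" "- k"] D_minus[of "h + k"] D_minus[of h] D_minus[of k] by simp
  have D_scale: "D (c *\<^sub>R h) = c * D h" for c h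
  proof -
    consider "c > 0" | "c = 0" | "- c > 0" by linarith
    then show ?thesis
    proof cases
      case 3
      then show ?thesis using D_scale_pos[of "- c" h] D_minus[of "c *\<^sub>R h"] by simp
    qed (auto simp: D_scale_pos D0)
  qed
  have D_abs: "\<bar>D h\<bar> \<le> norm h" for h
    using D_upper[of h] D_upper[of "- h"] D_minus[of h] by simp
  have "bounded_linear D"
    by (rule bounded_linear_intro[where K = 1]) (auto simp: D_add D_scale D_abs)
  then have app: "blinfun_apply (Blinfun D) = D" by (rule bounded_linear_Blinfun_apply)
  have Qx: "Q s x = 1" if "s > 0" for s
  proof -
    have "x + s *\<^sub>R x = (1 + s) *\<^sub>R x" by (simp add: scaleR_left_distrib)
    then show ?thesis using that x by (simp add: Q_def)
  qed
  have Dx: "D x = 1"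
  proof (rule antisym)
    show "D x \<le> 1" using D_le[of 1 x] Qx[of 1] by simp
    show "1 \<le> D x" by (rule D_ge) (simp add: Qx)
  qed
  have "norm (Blinfun D) \<le> 1"
  proof (rule norm_blinfun_bound)
    show "norm (blinfun_apply (Blinfun D) h) \<le> 1 * norm h" for h using D_abs[of h] by (simp add: app)
  qed simp
  moreover have "1 \<le> norm (Blinfun D)"
    using norm_blinfun[of "Blinfun D" x] x by (simp add: app Dx)
  ultimately have "norm (Blinfun D) = 1" by simp
  then show ?thesis by (rule that) (simp only: app Dx)
qed

lemma smooth_norming_functional:
  fixes x :: "'x::real_normed_vector"
  assumes us: "uniformly_smooth TYPE('x)" and x: "x \<noteq> 0"
  obtains f :: "'x dual" where "norm f = 1" "blinfun_apply f x = norm x"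
proof -
  obtain f :: "'x dual" where f: "norm f = 1" "blinfun_apply f (sgn x) = 1"
    using smooth_supporting_functional[OF us, of "sgn x"] x by (auto simp: norm_sgn)
  have "blinfun_apply f (norm x *\<^sub>R sgn x) = norm x"
    using f(2) by (simp only: blinfun.scaleR_right) simp
  then show ?thesis using that[OF f(1)] x by (simp add: sgn_div_norm)
qed

text \<open>A functional \<open>\<phi>\<close> on the dual attains its norm at some \<open>f\<close>, and \<open>f\<close> attains its norm at
  some \<open>x\<close>. The norming points of \<open>f + s g\<close> converge to \<open>x\<close> as \<open>s\<close> decreases to 0, which forces
  \<open>\<phi> g\<close> to be at most \<open>\<parallel>\<phi>\<parallel> g x\<close>.\<close>

lemma bidual_embed_surj:
  assumes uc: "uniformly_convex TYPE('x::banach)" and ucd: "uniformly_convex TYPE('x dual)"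
  shows "surj (bidual_embed :: 'x \<Rightarrow> 'x dual dual)"
proof -
  have "\<exists>x :: 'x. \<phi> = bidual_embed x" for \<phi> :: "'x dual dual"
  proof (cases "\<phi> = 0")
    case True
    have "bidual_embed (0 :: 'x) = 0" by (rule blinfun_eqI) (simp add: blinfun.zero_right blinfun.zero_left)
    then show ?thesis using True by metis
  next
    case False
    obtain f where f: "norm f = 1" "blinfun_apply \<phi> f = norm \<phi>"
      using norm_attained[OF ucd False] by blast
    then have "f \<noteq> 0" by auto
    then obtain x where x: "norm x = 1" "blinfun_apply f x = 1"
      using norm_attained[OF uc] f(1) by metis
    \<comment> \<open>The ball replaces the sphere so that a vanishing
      \<open>f + s n *\<^sub>R g\<close> is covered as well.\<close>
    have att: "\<exists>y :: 'x. norm y \<le> 1 \<and> blinfun_apply h y = norm h" for h :: "'x dual"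
    proof (cases "h = 0")
      case True then show ?thesis by (intro exI[of _ 0]) (simp add: blinfun.zero_left)
    next
      case False then show ?thesis using norm_attained[OF uc False] by (metis order_refl)
    qed
    have le: "blinfun_apply \<phi> g \<le> norm \<phi> * blinfun_apply g x" for g
    proof -
      define s where "s n = inverse (real (Suc n))" for n
      have s: "s n > 0" "s \<longlonglongrightarrow> 0" for n
        unfolding s_def using LIMSEQ_inverse_real_of_nat by auto
      obtain y where y: "\<And>n. norm (y n :: 'x) \<le> 1"
          "\<And>n. blinfun_apply (f + s n *\<^sub>R g) (y n) = norm (f + s n *\<^sub>R g)"
        using choice[of "\<lambda>n y. norm y \<le> 1 \<and> blinfun_apply (f + s n *\<^sub>R g) y = norm (f + s n *\<^sub>R g)"]
          att by auto
      have f_le: "blinfun_apply f z \<le> norm z" for z using norm_blinfun[of f z] f(1) by simp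
      have g_le: "blinfun_apply g (y n) \<le> norm g" for n
      proof -
        have "blinfun_apply g (y n) \<le> norm g * norm (y n)" using norm_blinfun[of g "y n"] by simp
        also have "\<dots> \<le> norm g * 1" using y(1)[of n] by (intro mult_left_mono) auto
        finally show ?thesis by simp
      qed
      have fy: "1 - 2 * (s n * norm g) \<le> blinfun_apply f (y n)" for n
      proof -
        have "1 - s n * norm g \<le> norm (f + s n *\<^sub>R g)"
          using norm_diff_ineq[of f "s n *\<^sub>R g"] f(1) s(1)[of n] by simp
        moreover have "s n * blinfun_apply g (y n) \<le> s n * norm g"
          using g_le s(1)[of n] by simp
        ultimately show ?thesis using y(2)[of n] by (simp add: blinfun.bilinear_simps)
      qed
      have lim: "(\<lambda>n. c - 2 * (s n * norm g)) \<longlonglongrightarrow> c" for c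
        using tendsto_diff[OF tendsto_const tendsto_mult[OF tendsto_const tendsto_mult[OF s(2) tendsto_const]], of c 2 "norm g"] by simp
      have ny: "(\<lambda>n. norm (y n)) \<longlonglongrightarrow> 1"
      proof (rule tendsto_sandwich[OF _ _ lim tendsto_const])
        show "\<forall>\<^sub>F n in sequentially. 1 - 2 * (s n * norm g) \<le> norm (y n)"
          by (intro always_eventually allI order_trans[OF fy f_le])
        show "\<forall>\<^sub>F n in sequentially. norm (y n) \<le> 1" using y(1) by simp
      qed
      have low: "2 - 2 * (s n * norm g) \<le> norm (y n + x)" for n
        using fy[of n] f_le[of "y n + x"] x(2) by (simp add: blinfun.add_right)
      have "(\<lambda>n. y n - x) \<longlonglongrightarrow> 0"
        using lim[of 2] x(1) by (intro uniformly_convex_seq[OF uc ny _ low]) simp_all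
      then have yx: "y \<longlonglongrightarrow> x" by (rule LIM_zero_cancel)
      \<comment> \<open>Expand \<phi> at \<open>f + s n *\<^sub>R g\<close> and bound it by the
        norm, which is attained at \<open>y n\<close>; the zeroth-order terms cancel because
        \<open>f (y n) \<le> 1\<close>, and division by \<open>s n\<close> remains.\<close>
      have "blinfun_apply \<phi> g \<le> norm \<phi> * blinfun_apply g (y n)" for n
      proof -
        have "norm \<phi> + s n * blinfun_apply \<phi> g = blinfun_apply \<phi> (f + s n *\<^sub>R g)"
          using f by (simp add: blinfun.bilinear_simps)
        also have "\<dots> \<le> norm \<phi> * norm (f + s n *\<^sub>R g)"
          using norm_blinfun[of \<phi> "f + s n *\<^sub>R g"] by simp
        also have "\<dots> = norm \<phi> * (blinfun_apply f (y n) + s n * blinfun_apply g (y n))"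
          using y(2)[of n] by (simp add: blinfun.bilinear_simps)
        also have "\<dots> \<le> norm \<phi> * (1 + s n * blinfun_apply g (y n))"
          using order_trans[OF f_le y(1), of n] by (intro mult_left_mono) auto
        finally have "s n * blinfun_apply \<phi> g \<le> s n * (norm \<phi> * blinfun_apply g (y n))"
          by (simp add: algebra_simps)
        then show ?thesis using s(1)[of n] by simp
      qed
      moreover have "(\<lambda>n. norm \<phi> * blinfun_apply g (y n)) \<longlonglongrightarrow> norm \<phi> * blinfun_apply g x"
        by (intro tendsto_mult tendsto_const bounded_linear.tendsto[OF blinfun.bounded_linear_right yx])
      ultimately show ?thesis by (intro LIMSEQ_le_const) auto
    qed
    have "\<phi> = bidual_embed (norm \<phi> *\<^sub>R x)"
    proof (rule blinfun_eqI)
      fix g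
      show "blinfun_apply \<phi> g = blinfun_apply (bidual_embed (norm \<phi> *\<^sub>R x)) g"
        using le[of g] le[of "- g"] by (simp add: blinfun.bilinear_simps)
    qed
    then show ?thesis by blast
  qed
  then show ?thesis by (metis surjI)
qed

section \<open>The two concrete duality mappings\<close>

text \<open>The definite description is legitimate: a scaled supporting functional gives existence,
  strict convexity of the dual gives uniqueness.\<close>

lemma duality_map_pair:
  assumes us: "uniformly_smooth TYPE('x::banach)" and uc: "uniformly_convex TYPE('x)" and p: "p > 1"
  shows "duality_pair (\<lambda>x f. blinfun_apply f x) (duality_map p :: 'x \<Rightarrow> 'x dual) p"
proof -
  note ucd = uniformly_convex_dual[OF us]
  have spec: "blinfun_apply (duality_map p x) x = norm x * norm (duality_map p x)
      \<and> norm (duality_map p x) = norm x powr (p - 1)" for x :: 'x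
    unfolding duality_map_def
  proof (rule theI', rule ex_ex1I)
    show "\<exists>f. blinfun_apply f x = norm x * norm f \<and> norm f = norm x powr (p - 1)"
    proof (cases "x = 0")
      case True
      then show ?thesis by (intro exI[of _ 0]) (simp add: blinfun.zero_left)
    next
      case False
      then obtain f where f: "norm f = 1" "blinfun_apply f x = norm x"
        using smooth_norming_functional[OF us] by blast
      then show ?thesis
        by (intro exI[of _ "(norm x powr (p - 1)) *\<^sub>R f"]) (simp add: blinfun.scaleR_left)
    qed
  next
    fix f g :: "'x dual"
    assume f: "blinfun_apply f x = norm x * norm f \<and> norm f = norm x powr (p - 1)"
      and g: "blinfun_apply g x = norm x * norm g \<and> norm g = norm x powr (p - 1)"
    show "f = g"
    proof (cases "x = 0")
      case False
      have "norm x * (2 * norm x powr (p - 1)) = blinfun_apply (f + g) x"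
        using f g by (simp add: blinfun.add_left)
      also have "\<dots> \<le> norm x * norm (f + g)"
        using norm_blinfun[of "f + g" x] by (simp add: mult.commute)
      finally have "2 * norm x powr (p - 1) \<le> norm (f + g)" using False by simp
      then show ?thesis using f g by (intro uniformly_convex_strict[OF ucd, of f _ g]) auto
    qed (use f g in simp)
  qed
  show ?thesis
  proof (rule duality_pair.intro)
    show "bounded_bilinear (\<lambda>(x::'x) f. blinfun_apply f x :: real)"
      by (rule bounded_bilinear.flip[OF bounded_bilinear_blinfun_apply])
    show "blinfun_apply f x \<le> norm x * norm f" for x :: 'x and f
      using norm_blinfun[of f x] by (simp add: mult.commute)
  qed (use spec uc ucd p in auto)
qed

lemma norm_bidual_embed:
  assumes us: "uniformly_smooth TYPE('x::real_normed_vector)"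
  shows "norm (bidual_embed (x :: 'x)) = norm x"
proof (rule antisym)
  show "norm (bidual_embed x) \<le> norm x"
  proof (rule norm_blinfun_bound)
    show "norm (blinfun_apply (bidual_embed x) f) \<le> norm x * norm f" for f
      using norm_blinfun[of f x] by (simp add: mult.commute)
  qed simp
  show "norm x \<le> norm (bidual_embed x)"
  proof (cases "x = 0")
    case False
    then obtain f where f: "norm f = 1" "blinfun_apply f x = norm x"
        using smooth_norming_functional[OF us] by blast
    then show ?thesis using norm_blinfun[of "bidual_embed x" f] by simp
  qed simp
qed

lemma inj_bidual_embed:
  assumes us: "uniformly_smooth TYPE('x::real_normed_vector)"
  shows "inj (bidual_embed :: 'x \<Rightarrow> 'x dual dual)"
proof (rule injI)
  fix x y :: 'x
  assume "bidual_embed x = bidual_embed y"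
  then have "bidual_embed (x - y) = 0"
    by (intro blinfun_eqI) (metis bidual_embed_apply blinfun.diff_right blinfun.zero_left right_minus_eq)
  then show "x = y" using norm_bidual_embed[OF us, of "x - y"] by simp
qed

text \<open>A candidate value is found in the space itself by norm attainment. Reflexivity then
  turns any competitor in the bidual into a vector, and strict convexity of the space identifies the
  two.\<close>

lemma predual_duality_map_pair:
  assumes us: "uniformly_smooth TYPE('x::banach)" and uc: "uniformly_convex TYPE('x)" and q: "q > 1"
  shows "duality_pair (blinfun_apply :: 'x dual \<Rightarrow> _) (predual_duality_map q) q"
proof -
  note ucd = uniformly_convex_dual[OF us]
  have spec: "blinfun_apply f (predual_duality_map q f) = norm f * norm (predual_duality_map q f)
      \<and> norm (predual_duality_map q f) = norm f powr (q - 1)" for f :: "'x dual"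
  proof -
    have "\<exists>x. blinfun_apply f x = norm f * norm x \<and> norm x = norm f powr (q - 1)"
    proof (cases "f = 0")
      case True
      then show ?thesis by (intro exI[of _ 0]) (simp add: blinfun.zero_left)
    next
      case False
      then obtain x where "norm x = 1" "blinfun_apply f x = norm f"
        using norm_attained[OF uc] by blast
      then show ?thesis
        by (intro exI[of _ "(norm f powr (q - 1)) *\<^sub>R x"]) (simp add: blinfun.scaleR_right)
    qed
    then obtain x where x: "blinfun_apply f x = norm f * norm x" "norm x = norm f powr (q - 1)" by blast
    have "duality_map q f = bidual_embed x"
      unfolding duality_map_def
    proof (rule the_equality)
      show "blinfun_apply (bidual_embed x) f = norm f * norm (bidual_embed x)
          \<and> norm (bidual_embed x) = norm f powr (q - 1)"
        using x by (simp add: norm_bidual_embed[OF us])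
    next
      fix \<phi> :: "'x dual dual"
      assume \<phi>: "blinfun_apply \<phi> f = norm f * norm \<phi> \<and> norm \<phi> = norm f powr (q - 1)"
      obtain y where y: "\<phi> = bidual_embed y" using bidual_embed_surj[OF uc ucd] by (meson surjD)
      have ny: "norm y = norm f powr (q - 1)" "blinfun_apply f y = norm f * norm y"
        using \<phi> by (simp_all add: y norm_bidual_embed[OF us])
      have "y = x"
      proof (cases "f = 0")
        case False
        have "norm f * (2 * norm f powr (q - 1)) = blinfun_apply f (y + x)"
          using x ny by (simp add: blinfun.add_right)
        also have "\<dots> \<le> norm f * norm (y + x)" using norm_blinfun[of f "y + x"] by simp
        finally have "2 * norm f powr (q - 1) \<le> norm (y + x)" using False by simp
        then show ?thesis using x ny by (intro uniformly_convex_strict[OF uc]) auto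
      qed (use x ny in simp)
      then show "\<phi> = bidual_embed x" by (simp add: y)
    qed
    then have "predual_duality_map q f = x"
      by (simp add: predual_duality_map_def inv_f_f[OF inj_bidual_embed[OF us]])
    then show ?thesis using x by simp
  qed
  show ?thesis
  proof (rule duality_pair.intro)
    show "blinfun_apply f x \<le> norm f * norm x" for x :: 'x and f
      using norm_blinfun[of f x] by simp
  qed (use spec uc ucd q bounded_bilinear_blinfun_apply in auto)
qed

subsection \<open>The coupled system\<close>

lemma coupled_duality_system_solvable:
  fixes P :: "'x::banach \<Rightarrow> 'x dual" and Q :: "'x dual \<Rightarrow> 'x" and t :: real
  assumes us: "uniformly_smooth TYPE('x)" and uc: "uniformly_convex TYPE('x)"
    and pq: "p > 1" "q > 1" "1 / p + 1 / q = 1"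
    and P_mono: "\<And>x y. 0 \<le> blinfun_apply (P x - P y) (x - y)"
    and P_max: "\<And>x a. (\<And>y. 0 \<le> blinfun_apply (a - P y) (x - y)) \<Longrightarrow> a = P x"
    and Q_mono: "\<And>f g. 0 \<le> blinfun_apply (f - g) (Q f - Q g)"
    and Q_max: "\<And>f b. (\<And>g. 0 \<le> blinfun_apply (f - g) (b - Q g)) \<Longrightarrow> b = Q f"
  obtains u v where "duality_map p u + P u = t *\<^sub>R v" "predual_duality_map q v + Q v = - t *\<^sub>R u"
proof -
  have pq': "1 / q + 1 / p = 1" using pq by simp
  let ?Jp = "duality_map p :: 'x \<Rightarrow> 'x dual" and ?Jq = "predual_duality_map q :: 'x dual \<Rightarrow> 'x"
  interpret E: duality_pair "\<lambda>(x::'x) f. blinfun_apply f x" ?Jp p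
    by (rule duality_map_pair[OF us uc pq(1)])
  interpret D: duality_pair "blinfun_apply :: 'x dual \<Rightarrow> _" ?Jq q
    by (rule predual_duality_map_pair[OF us uc pq(2)])
  note ex = conjugate_exponents[OF pq]
  note bl = blinfun.bilinear_simps

  text \<open>\<open>C\<close> is the epigraph of the Fitzpatrick function of \<open>P\<close> at \<open>(u, a + t v)\<close> plus that of \<open>Q\<close>
    at \<open>(v, b - t u)\<close>; the two occurrences of \<open>t v u\<close> cancel in the pairing.\<close>
  define aff where "aff y z u v a b =
      blinfun_apply (P y) u + blinfun_apply (a + t *\<^sub>R v) y - blinfun_apply (P y) y
      + (blinfun_apply v (Q z) + blinfun_apply z (b - t *\<^sub>R u) - blinfun_apply z (Q z))"
    for y u b :: 'x and z v a :: "'x dual"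
  define C where "C = {w. \<forall>y z. aff y z (fst (fst (fst w))) (snd (fst (fst w)))
      (fst (snd (fst w))) (snd (snd (fst w))) \<le> snd w}"
  have C_iff: "(((u, v), (a, b)), s) \<in> C \<longleftrightarrow> (\<forall>y z. aff y z u v a b \<le> s)" for u v a b s
    by (simp add: C_def)
  define g :: "('x \<times> 'x dual) \<times> ('x dual \<times> 'x) \<Rightarrow> real" where
    "g w = (norm (fst (fst w)) powr p / p + norm (snd (fst w)) powr q / q)
      + (norm (fst (snd w)) powr q / q + norm (snd (snd w)) powr p / p)" for w

  \<comment> \<open>Here \<open>a + t *\<^sub>R v\<close> is \<open>P y\<close> and
    \<open>b - t *\<^sub>R u\<close> is \<open>Q z\<close>, so monotonicity says precisely that no
    affine minorant exceeds the pairing.\<close>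
  have graph: "(((y, z), (P y - t *\<^sub>R z, Q z + t *\<^sub>R y)), blinfun_apply (P y) y + blinfun_apply z (Q z)) \<in> C"
    for y z
    unfolding C_iff
  proof (intro allI)
    fix y' z'
    show "aff y' z' y z (P y - t *\<^sub>R z) (Q z + t *\<^sub>R y) \<le> blinfun_apply (P y) y + blinfun_apply z (Q z)"
      using P_mono[of y y'] Q_mono[of z z'] by (simp add: aff_def bl)
  qed

  \<comment> \<open>On the graph \<open>y = u\<close> gives equality. Off the graph, maximality
    supplies a \<open>y\<close> violating the monotone relation, and expanding that violation is the
    strict inequality.\<close>
  have P_rep: "\<exists>y. blinfun_apply \<alpha> u \<le> blinfun_apply (P y) u + blinfun_apply \<alpha> y - blinfun_apply (P y) y
      \<and> (\<alpha> \<noteq> P u \<longrightarrow> blinfun_apply \<alpha> u < blinfun_apply (P y) u + blinfun_apply \<alpha> y - blinfun_apply (P y) y)"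
    for \<alpha> u
  proof (cases "\<alpha> = P u")
    case False
    then obtain y where "\<not> 0 \<le> blinfun_apply (\<alpha> - P y) (u - y)" using P_max by blast
    then show ?thesis by (intro exI[of _ y]) (simp add: bl)
  qed (auto intro: exI[of _ u])
  have Q_rep: "\<exists>z. blinfun_apply v \<beta> \<le> blinfun_apply v (Q z) + blinfun_apply z \<beta> - blinfun_apply z (Q z)
      \<and> (\<beta> \<noteq> Q v \<longrightarrow> blinfun_apply v \<beta> < blinfun_apply v (Q z) + blinfun_apply z \<beta> - blinfun_apply z (Q z))"
    for \<beta> v
  proof (cases "\<beta> = Q v")
    case False
    then obtain z where "\<not> 0 \<le> blinfun_apply (v - z) (\<beta> - Q z)" using Q_max by blast
    then show ?thesis by (intro exI[of _ z]) (simp add: bl)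
  qed (auto intro: exI[of _ v])
  have pairing: "blinfun_apply a u + blinfun_apply v b \<le> s
      \<and> (s \<le> blinfun_apply a u + blinfun_apply v b \<longrightarrow> a + t *\<^sub>R v = P u \<and> b - t *\<^sub>R u = Q v)"
    if w: "(((u, v), (a, b)), s) \<in> C" for u v a b s
  proof -
    obtain y where y: "blinfun_apply (a + t *\<^sub>R v) u
          \<le> blinfun_apply (P y) u + blinfun_apply (a + t *\<^sub>R v) y - blinfun_apply (P y) y"
        "a + t *\<^sub>R v \<noteq> P u \<Longrightarrow> blinfun_apply (a + t *\<^sub>R v) u
          < blinfun_apply (P y) u + blinfun_apply (a + t *\<^sub>R v) y - blinfun_apply (P y) y"
      using P_rep[where \<alpha> = "a + t *\<^sub>R v" and u = u] by blast
    obtain z where z: "blinfun_apply v (b - t *\<^sub>R u)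
          \<le> blinfun_apply v (Q z) + blinfun_apply z (b - t *\<^sub>R u) - blinfun_apply z (Q z)"
        "b - t *\<^sub>R u \<noteq> Q v \<Longrightarrow> blinfun_apply v (b - t *\<^sub>R u)
          < blinfun_apply v (Q z) + blinfun_apply z (b - t *\<^sub>R u) - blinfun_apply z (Q z)"
      using Q_rep[where \<beta> = "b - t *\<^sub>R u" and v = v] by blast
    have "aff y z u v a b \<le> s" using w by (simp add: C_iff)
    moreover have "blinfun_apply (a + t *\<^sub>R v) u + blinfun_apply v (b - t *\<^sub>R u) = blinfun_apply a u + blinfun_apply v b"
      by (simp add: bl)
    ultimately show ?thesis using y z unfolding aff_def by linarith
  qed

  have g_uc: "uniformly_convex_on_bounded g"
    unfolding g_def
    by (intro uniformly_convex_on_bounded_prod[of "\<lambda>w. norm (fst w) powr p / p + norm (snd w) powr q / q"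
          "\<lambda>w. norm (fst w) powr q / q + norm (snd w) powr p / p"]
        uniformly_convex_on_bounded_prod[of "\<lambda>x. norm x powr p / p" "\<lambda>x. norm x powr q / q"]
        uniformly_convex_on_bounded_prod[of "\<lambda>x. norm x powr q / q" "\<lambda>x. norm x powr p / p"]
        norm_powr_uniformly_convex_on_bounded E.X_uc E.Y_uc pq)
  have g_cont: "continuous_on UNIV g"
    unfolding g_def using pq by (intro continuous_intros continuous_on_powr') auto
  have C_closed: "closed C"
    unfolding C_def aff_def
    by (intro closed_Collect_all closed_Collect_le continuous_intros blinfun.continuous_on)
  have C_convex: "convex C"
  proof (rule convexI)
    fix w w' and l m :: real
    assume w: "w \<in> C" "w' \<in> C" and lm: "0 \<le> l" "0 \<le> m" "l + m = 1"
    obtain u v a b s where W: "w = (((u, v), (a, b)), s)" by (metis prod.collapse)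
    obtain u' v' a' b' s' where W': "w' = (((u', v'), (a', b')), s')" by (metis prod.collapse)
    have "aff y z (l *\<^sub>R u + m *\<^sub>R u') (l *\<^sub>R v + m *\<^sub>R v') (l *\<^sub>R a + m *\<^sub>R a') (l *\<^sub>R b + m *\<^sub>R b') \<le> l * s + m * s'"
      for y z
    proof -
      have l: "l = 1 - m" using lm by simp
      have "aff y z (l *\<^sub>R u + m *\<^sub>R u') (l *\<^sub>R v + m *\<^sub>R v') (l *\<^sub>R a + m *\<^sub>R a') (l *\<^sub>R b + m *\<^sub>R b')
          = l * aff y z u v a b + m * aff y z u' v' a' b'"
        unfolding aff_def l by (simp add: bl algebra_simps)
      also have "\<dots> \<le> l * s + m * s'"
        using w lm by (intro add_mono mult_left_mono) (simp_all add: W W' C_iff)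
      finally show ?thesis .
    qed
    then show "l *\<^sub>R w + m *\<^sub>R w' \<in> C" by (simp add: W W' C_iff)
  qed
  have C_ne: "C \<noteq> {}" using graph by blast
  have bdd: "0 \<le> s + g w" if "(w, s) \<in> C" for w s
  proof -
    obtain u v a b where w: "w = ((u, v), (a, b))" by (metis prod.collapse)
    show ?thesis
      using pairing[OF that[unfolded w]] E.Fenchel_Young(1)[OF pq(2,3), where x = u and y = a]
        D.Fenchel_Young(1)[OF pq(1) pq', where x = v and y = b]
      by (simp add: w g_def)
  qed
  have coercive: "\<exists>R. \<forall>(w, s)\<in>C. s + g w \<le> c \<longrightarrow> norm w \<le> R" for c
  proof -
    \<comment> \<open>The minorant \<open>aff 0 0\<close> costs at most
      \<open>norm (P 0) * norm u + norm (Q 0) * norm v\<close>. Young's inequality with both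
      constants raised by 1 absorbs this and still leaves \<open>norm u + norm v\<close>; the
      constant 1 does the same for \<open>a\<close> and \<open>b\<close>, and \<open>R\<close>
      collects the remainders.\<close>
    define k1 k2 where "k1 = norm (P 0) + 1" and "k2 = norm (Q 0) + 1"
    have k: "k1 \<ge> 0" "k2 \<ge> 0" by (simp_all add: k1_def k2_def)
    define R where "R = c + k1 powr q / q + k2 powr p / p + 1 / p + 1 / q"
    have "norm w \<le> R" if wC: "(w, s) \<in> C" and le: "s + g w \<le> c" for w s
    proof -
      obtain u v a b where w: "w = ((u, v), (a, b))" by (metis prod.collapse)
      have "blinfun_apply (P 0) u + blinfun_apply v (Q 0) \<le> s"
        using wC[unfolded w C_iff, rule_format, of 0 0] by (simp add: aff_def bl)
      moreover have "- (norm (P 0) * norm u) \<le> blinfun_apply (P 0) u" "- (norm (Q 0) * norm v) \<le> blinfun_apply v (Q 0)"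
        using norm_blinfun[of "P 0" u] norm_blinfun[of v "Q 0"] by (auto simp: mult.commute)
      moreover have "norm u * k1 \<le> norm u powr p / p + k1 powr q / q"
        using k by (intro Young_powr(1)[OF pq]) auto
      moreover have "norm v * k2 \<le> norm v powr q / q + k2 powr p / p"
        using k by (intro Young_powr(1)[OF pq(2,1) pq']) auto
      moreover have "norm a * 1 \<le> norm a powr q / q + 1 powr p / p"
        by (intro Young_powr(1)[OF pq(2,1) pq']) auto
      moreover have "norm b * 1 \<le> norm b powr p / p + 1 powr q / q"
        by (intro Young_powr(1)[OF pq]) auto
      moreover have "norm u * k1 = norm (P 0) * norm u + norm u" "norm v * k2 = norm (Q 0) * norm v + norm v"
        by (simp_all add: k1_def k2_def algebra_simps)
      ultimately have "norm u + norm v + (norm a + norm b) \<le> R"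
        using le unfolding R_def w g_def by simp
      moreover have "norm w \<le> norm u + norm v + (norm a + norm b)"
        unfolding w using norm_Pair_le[of "(u, v)" "(a, b)"] norm_Pair_le[of u v] norm_Pair_le[of a b] by linarith
      ultimately show ?thesis by linarith
    qed
    then show ?thesis by blast
  qed

  obtain w0 s0 where w0C: "(w0, s0) \<in> C" and minim: "\<And>w s. (w, s) \<in> C \<Longrightarrow> s0 + g w0 \<le> s + g w"
    using convex_minimizer_exists[where g = g, OF g_uc g_cont C_closed C_convex C_ne bdd coercive] by blast
  obtain u0 v0 a0 b0 where w0: "w0 = ((u0, v0), (a0, b0))" by (metis prod.collapse)

  have optimal: "s0 \<le> s + (blinfun_apply (?Jp u0) (u - u0) + blinfun_apply (v - v0) (?Jq v0)
      + (blinfun_apply (a - a0) (?Jq a0) + blinfun_apply (?Jp b0) (b - b0)))"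
    if w: "(((u, v), (a, b)), s) \<in> C" for u v a b s
  proof -
    define l where "l n = inverse (real (Suc n))" for n
    have lim: "(\<lambda>n. x + l n *\<^sub>R h) \<longlonglongrightarrow> x" for x h :: "'z::real_normed_vector"
      using tendsto_add[OF tendsto_const tendsto_scaleR[OF LIMSEQ_inverse_real_of_nat tendsto_const], of x h]
      by (simp add: l_def)
    \<comment> \<open>The gradient of \<open>g\<close> at the moved point, as delivered by
      \<open>J_directional\<close>; continuity of the duality mappings yields the limit.\<close>
    define d where "d n = blinfun_apply (?Jp (u0 + l n *\<^sub>R (u - u0))) (u - u0)
      + blinfun_apply (v - v0) (?Jq (v0 + l n *\<^sub>R (v - v0)))
      + (blinfun_apply (a - a0) (?Jq (a0 + l n *\<^sub>R (a - a0)))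
      + blinfun_apply (?Jp (b0 + l n *\<^sub>R (b - b0))) (b - b0))" for n
    show ?thesis
    proof (rule convex_minimizer_variational[where g = g and d = d, OF C_convex w0C minim w])
      show "g (w0 + inverse (real (Suc n)) *\<^sub>R (((u, v), (a, b)) - w0)) \<le> g w0 + inverse (real (Suc n)) * d n" for n
        using E.J_directional[of u0 "l n" "u - u0"] D.J_directional[of v0 "l n" "v - v0"]
          D.J_directional[of a0 "l n" "a - a0"] E.J_directional[of b0 "l n" "b - b0"]
        unfolding l_def[symmetric] d_def g_def w0 by (simp add: distrib_left)
      show "d \<longlonglongrightarrow> blinfun_apply (?Jp u0) (u - u0) + blinfun_apply (v - v0) (?Jq v0)
          + (blinfun_apply (a - a0) (?Jq a0) + blinfun_apply (?Jp b0) (b - b0))"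
        unfolding d_def
        by (intro tendsto_add blinfun.tendsto tendsto_const E.J_tendsto D.J_tendsto lim)
    qed
  qed

  text \<open>Testing optimality on the graphs of \<open>P\<close> and \<open>Q\<close> puts the negative gradient at the minimiser
    back into \<open>C\<close>. The pairing bounds at both points then sum up to an equality in Young's inequality.\<close>
  define \<kappa> where "\<kappa> = - (norm u0 powr p + norm v0 powr q + norm a0 powr q + norm b0 powr p)"
  have "(((- ?Jq a0, - ?Jp b0), (- ?Jp u0, - ?Jq v0)), \<kappa> - s0) \<in> C"
    unfolding C_iff
  proof (intro allI)
    fix y z
    show "aff y z (- ?Jq a0) (- ?Jp b0) (- ?Jp u0) (- ?Jq v0) \<le> \<kappa> - s0"
      using optimal[OF graph[of y z]] E.B_J_powr[of u0] D.B_J_powr[of v0] D.B_J_powr[of a0] E.B_J_powr[of b0]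
      unfolding aff_def \<kappa>_def by (simp add: bl)
  qed
  from conjunct1[OF pairing[OF this]]
  have dual: "blinfun_apply (?Jp u0) (?Jq a0) + blinfun_apply (?Jp b0) (?Jq v0) \<le> \<kappa> - s0"
    by (simp add: bl)
  have split: "c / p + c / q = c" for c
    using pq(3) by (metis distrib_left mult.right_neutral times_divide_eq_right)
  \<comment> \<open>Young's inequality for the dual pair: since \<open>(q - 1) * p = q\<close> and
    \<open>(p - 1) * q = p\<close>, the same powers return with the factors \<open>1 / p\<close> and
    \<open>1 / q\<close> exchanged, complementary to \<open>F1\<close> and
    \<open>F2\<close>.\<close>
  have JF: "0 \<le> blinfun_apply (?Jp x) (?Jq f) + (norm f powr q / p + norm x powr p / q)" for x f
    using E.Fenchel_Young(1)[OF pq(2,3), where x = "?Jq f" and y = "?Jp x"] ex by (simp add: E.norm_J D.norm_J powr_powr)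
  note F1 = E.Fenchel_Young[OF pq(2,3), where x = u0 and y = a0] and F2 = D.Fenchel_Young[OF pq(1) pq', where x = v0 and y = b0]
  have primal: "blinfun_apply a0 u0 + blinfun_apply v0 b0 \<le> s0"
    and primal_eq: "s0 \<le> blinfun_apply a0 u0 + blinfun_apply v0 b0 \<Longrightarrow> a0 + t *\<^sub>R v0 = P u0 \<and> b0 - t *\<^sub>R u0 = Q v0"
    using pairing[OF w0C[unfolded w0]] by auto
  note slack = dual primal F1(1) F2(1) JF[of u0 a0] JF[of b0 v0] \<kappa>_def
    split[of "norm u0 powr p"] split[of "norm v0 powr q"] split[of "norm a0 powr q"] split[of "norm b0 powr p"]
  \<comment> \<open>The four Young lower bounds add up to exactly \<kappa>, while
    \<open>dual\<close> and \<open>primal\<close> bound the same sum of pairings above by \<kappa>;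
    hence all six inequalities are equalities.\<close>
  have "s0 \<le> blinfun_apply a0 u0 + blinfun_apply v0 b0" using slack by linarith
  then have inc: "P u0 = a0 + t *\<^sub>R v0" "Q v0 = b0 - t *\<^sub>R u0" using primal_eq by auto
  have "?Jp u0 = - a0" by (rule F1(2)) (use slack in linarith)
  moreover have "?Jq v0 = - b0" by (rule F2(2)) (use slack in linarith)
  ultimately show ?thesis using inc that[of u0 v0] by simp
qed

section \<open>The dual of the product space and the range condition\<close>

lemma pair_dual_add_scaleR:
  "pair_dual (a, b) + t *\<^sub>R pair_dual (c, d) = pair_dual (a + t *\<^sub>R c, b + t *\<^sub>R d)"
proof (rule blinfun_eqI)
  fix w :: "('a, 'a dual) l1_prod"
  show "blinfun_apply (pair_dual (a, b) + t *\<^sub>R pair_dual (c, d)) w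
      = blinfun_apply (pair_dual (a + t *\<^sub>R c, b + t *\<^sub>R d)) w"
    by (cases w) (simp add: blinfun.bilinear_simps algebra_simps)
qed

text \<open>Restrict \<phi> to the two coordinate axes. The second restriction is a functional on
  the dual, which reflexivity represents by a vector \<open>b\<close>.\<close>

lemma pair_dual_surj:
  fixes \<phi> :: "('x::real_normed_vector, 'x dual) l1_prod dual"
  assumes reflexive: "surj (bidual_embed :: 'x \<Rightarrow> _)"
  obtains a b where "\<phi> = pair_dual (a, b)"
proof -
  have "bounded_linear (\<lambda>u :: 'x. L1 u (0 :: 'x dual))"
    by (rule bounded_linear_intro[where K = 1]) (auto simp: plus_l1_prod_def scaleR_l1_prod_def norm_l1_prod_def)
  then have "bounded_linear (\<lambda>u. blinfun_apply \<phi> (L1 u 0))"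
    by (rule bounded_linear_compose[OF blinfun.bounded_linear_right])
  then have a: "blinfun_apply (Blinfun (\<lambda>u. blinfun_apply \<phi> (L1 u 0))) = (\<lambda>u. blinfun_apply \<phi> (L1 u 0))"
    by (rule bounded_linear_Blinfun_apply)
  have "bounded_linear (\<lambda>v :: 'x dual. L1 (0 :: 'x) v)"
    by (rule bounded_linear_intro[where K = 1]) (auto simp: plus_l1_prod_def scaleR_l1_prod_def norm_l1_prod_def)
  then have "bounded_linear (\<lambda>v. blinfun_apply \<phi> (L1 0 v))"
    by (rule bounded_linear_compose[OF blinfun.bounded_linear_right])
  then have \<psi>: "blinfun_apply (Blinfun (\<lambda>v. blinfun_apply \<phi> (L1 0 v))) = (\<lambda>v. blinfun_apply \<phi> (L1 0 v))"
    by (rule bounded_linear_Blinfun_apply)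
  obtain b where b: "Blinfun (\<lambda>v. blinfun_apply \<phi> (L1 0 v)) = bidual_embed b"
    using reflexive by (meson surjD)
  have "\<phi> = pair_dual (Blinfun (\<lambda>u. blinfun_apply \<phi> (L1 u 0)), b)"
  proof (rule blinfun_eqI)
    fix w :: "('x, 'x dual) l1_prod"
    obtain u v where w: "w = L1 u v" by (cases w)
    have "blinfun_apply v b = blinfun_apply \<phi> (L1 0 v)"
      by (metis \<psi> b bidual_embed_apply)
    moreover have "L1 u v = L1 u 0 + L1 0 v" by (simp add: plus_l1_prod_def)
    then have "blinfun_apply \<phi> (L1 u v) = blinfun_apply \<phi> (L1 u 0) + blinfun_apply \<phi> (L1 0 v)"
      by (simp only: blinfun.add_right)
    ultimately show "blinfun_apply \<phi> w = blinfun_apply (pair_dual (Blinfun (\<lambda>u. blinfun_apply \<phi> (L1 u 0)), b)) w"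
      by (simp add: w a)
  qed
  then show ?thesis by (rule that)
qed

lemma gen_strongly_monotoneD:
  assumes "gen_strongly_monotone \<Phi> T"
  shows "0 \<le> blinfun_apply (T x - T y) (x - y)"
proof -
  have "0 \<le> \<Phi> (norm (x - y))" using assms by (auto simp: gen_strongly_monotone_def Pi_def)
  also have "\<dots> \<le> blinfun_apply (T x - T y) (x - y)" using assms by (simp add: gen_strongly_monotone_def)
  finally show ?thesis .
qed

theorem lemma3p4:
  fixes F :: "'a::banach \<Rightarrow> 'a dual"
    and K :: "'a dual \<Rightarrow> 'a"
    and \<Phi>\<^sub>1 \<Phi>\<^sub>2 :: "real \<Rightarrow> real"
    and p q :: real
  assumes "uniformly_smooth TYPE('a)"
    and "uniformly_convex TYPE('a)"
    and "p > 1" and "q > 1" and "1 / p + 1 / q = 1"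
    and "gen_strongly_monotone \<Phi>\<^sub>1 F"
    and "\<And>t\<^sub>1. t\<^sub>1 > 0 \<Longrightarrow> range (\<lambda>u. duality_map p u + t\<^sub>1 *\<^sub>R F u) = UNIV"
    and "gen_strongly_monotone \<Phi>\<^sub>2 (\<lambda>v. bidual_embed (K v))"
    and "\<And>t\<^sub>2. t\<^sub>2 > 0 \<Longrightarrow> range (\<lambda>v. predual_duality_map q v + t\<^sub>2 *\<^sub>R K v) = UNIV"
  shows "\<forall>t>0. range (\<lambda>w. duality_map_W p q w + t *\<^sub>R hammerstein_map F K w) = UNIV"
proof (intro allI impI)
  fix t :: real assume t: "t > 0"
  note us = assms(1) and uc = assms(2) and pq = assms(3-5)
  interpret E: duality_pair "\<lambda>(x::'a) f. blinfun_apply f x" "duality_map p" p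
    by (rule duality_map_pair[OF us uc pq(1)])
  interpret D: duality_pair "blinfun_apply :: 'a dual \<Rightarrow> _" "predual_duality_map q" q
    by (rule predual_duality_map_pair[OF us uc pq(2)])
  have "\<phi> \<in> range (\<lambda>w. duality_map_W p q w + t *\<^sub>R hammerstein_map F K w)" for \<phi>
  proof -
    obtain a b where \<phi>: "\<phi> = pair_dual (a, b)"
      using pair_dual_surj[OF bidual_embed_surj[OF uc uniformly_convex_dual[OF us]]] by blast
    define P where "P u = t *\<^sub>R F u - a" for u
    define Q where "Q v = t *\<^sub>R K v - b" for v
    have P_mono: "0 \<le> blinfun_apply (P x - P y) (x - y)" for x y
    proof -
      have "blinfun_apply (P x - P y) (x - y) = t * blinfun_apply (F x - F y) (x - y)"
        by (simp add: P_def blinfun.bilinear_simps algebra_simps)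
      then show ?thesis using gen_strongly_monotoneD[OF assms(6), of x y] t by simp
    qed
    have Q_mono: "0 \<le> blinfun_apply (f - g) (Q f - Q g)" for f g
    proof -
      have "blinfun_apply (f - g) (Q f - Q g) = t * blinfun_apply (bidual_embed (K f) - bidual_embed (K g)) (f - g)"
        by (simp add: Q_def blinfun.bilinear_simps algebra_simps)
      then show ?thesis using gen_strongly_monotoneD[OF assms(8), of f g] t by simp
    qed
    have P_surj: "range (\<lambda>u. duality_map p u + P u) = UNIV"
    proof -
      have "\<exists>u. c = duality_map p u + P u" for c
      proof -
        have "c + a \<in> range (\<lambda>u. duality_map p u + t *\<^sub>R F u)" using assms(7)[OF t] by simp
        then obtain u where "c + a = duality_map p u + t *\<^sub>R F u" by blast
        then show ?thesis by (intro exI[of _ u]) (simp add: P_def algebra_simps)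
      qed
      then show ?thesis by blast
    qed
    have Q_surj: "range (\<lambda>v. predual_duality_map q v + Q v) = UNIV"
    proof -
      have "\<exists>v. c = predual_duality_map q v + Q v" for c
      proof -
        have "c + b \<in> range (\<lambda>v. predual_duality_map q v + t *\<^sub>R K v)" using assms(9)[OF t] by simp
        then obtain v where "c + b = predual_duality_map q v + t *\<^sub>R K v" by blast
        then show ?thesis by (intro exI[of _ v]) (simp add: Q_def algebra_simps)
      qed
      then show ?thesis by blast
    qed
    obtain u v where uv: "duality_map p u + P u = t *\<^sub>R v" "predual_duality_map q v + Q v = - t *\<^sub>R u"
      using coupled_duality_system_solvable[OF us uc pq P_mono E.surjective_imp_maximal[OF P_surj]
          Q_mono D.surjective_imp_maximal[OF Q_surj]] by blast
    have "a = duality_map p u + t *\<^sub>R (F u - v)" "b = predual_duality_map q v + t *\<^sub>R (K v + u)"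
      using uv by (simp_all add: P_def Q_def algebra_simps)
    then have "\<phi> = duality_map_W p q (L1 u v) + t *\<^sub>R hammerstein_map F K (L1 u v)"
      by (simp add: \<phi> duality_map_W_def hammerstein_map_def pair_dual_add_scaleR)
    then show ?thesis by blast
  qed
  then show "range (\<lambda>w. duality_map_W p q w + t *\<^sub>R hammerstein_map F K w) = UNIV" by blast
qed

end
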